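(* The existence of a constant $p$-mean curvature surface (without singular points) in $H_1$ is equivalent to the existence of a solution of the Codazzi-like (Liénard) equation, in the following sense. (A) If $\Sigma\subset H_1$ is a surface without singular points whose $p$-mean curvature is a constant $H=c$, then in any compatible coordinate system $(U;x,y)$ on $\Sigma$ its $\alpha$-function satisfies $$\alpha_{xx}+6\alpha\alpha_x+4\alpha^3+c^2\alpha=0 .$$ (B) Let $\alpha(x,y)$ and $H(x,y)$ be two smooth functions on a coordinate neighborhood $(U;x,y)\subset\mathbb{R}^2$. Suppose that they satisfy the integrability condition $$\Big(h(y)-\int H\alpha\, e^{\int 2\alpha\,dx}\,dx\Big)H_x+e^{k(y)}H_y=e^{\int 2\alpha\,dx}\big(\alpha_{xx}+6\alpha\alpha_x+4\alpha^3+\alpha H^2\big)$$ for some functions $k(y)$ and $h(y)$ of the variable $y$. Then (provided $U$ is small enough) there exists an embedding $X:U\to H_1$ such that the surface $\Sigma=X(U)$ has $H$ and $\alpha$ as its $p$-mean curvature and $\alpha$-function, respectively, and (identifying $U$ with $\Sigma$ via $X$) $\hat e_1=\frac{\partial}{\partial x}$, $\hat e_2=a\frac{\partial}{\partial x}+b\frac{\partial}{\partial y}$, where $$b=e^{k(y)}\frac{e^{-\int 2\alpha\,dx}}{(1+\alpha^2)^{1/2}},\qquad a=\frac{e^{-\int 2\alpha\,dx}}{(1+\alpha^2)^{1/2}}\Big(h(y)-\int H\alpha\, e^{\int 2\alpha\,dx}\,dx\Big).$$ Moreover, such embeddings are unique up to a Heisenberg rigid motion. (C) In particular, when $H=c$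 is constant, the integrability condition in (B) reads $\alpha_{xx}+6\alpha\alpha_x+4\alpha^3+c^2\alpha=0$ for each pair of functions $k(y),h(y)$, and the resulting surface $\Sigma=X(U)$ is a constant $p$-mean curvature surface with $H=c$, with the given function $\alpha(x,y)$ as its $\alpha$-function, and with $\hat e_1=\frac{\partial}{\partial x}$.
   Context: The Heisenberg group $H_1$ is $\mathbb{R}^3$ with the group law $(x_1,y_1,z_1)\circ(x_2,y_2,z_2)=(x_1+x_2,\,y_1+y_2,\,z_1+z_2+y_1x_2-x_1y_2)$. Left invariant fields: $\mathring e_1=\partial_x+y\partial_z$, $\mathring e_2=\partial_y-x\partial_z$, $T=\partial_z$. Contact form $\Theta=dz+x\,dy-y\,dx$, contact bundle $\xi=\ker\Theta=\mathrm{span}(\mathring e_1,\mathring e_2)$, $J:\xi\to\xi$ with $J\mathring e_1=\mathring e_2$, $J\mathring e_2=-\mathring e_1$. The adapted metric is the Riemannian metric for which $\mathring e_1,\mathring e_2,T$ are orthonormal; $\nabla$ is the connection for which $\mathring e_1,\mathring e_2,T$ are parallel. A Heisenberg rigid motion is a diffeomorphism of $H_1$ preserving $(J,\Theta)$. All objects are $C^\infty$. Let $\Sigma\subset H_1$ be a surface. A point $p\in\Sigma$ is singular if $T_p\Sigma=\xi_p$, otherwise regular. On the regular part choose a unit vector field $e_1\in T\Sigma\cap\xi$ (the characteristic direction, determined up to sign) and put $e_2=Je_1$. The $p$-mean curvature $H$ is defined by $\nabla_{e_1}e_2=-He_1$. The $\alpha$-function is the function $\alpha$ such that $\alpha e_2+T$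 is tangent to $\Sigma$. Put $\hat e_1=e_1$, $\hat e_2=\frac{\alpha e_2+T}{\sqrt{1+\alpha^2}}$; this is an orthonormal frame of $T\Sigma$ for the induced metric. A compatible coordinate system on (an open part of) the regular part is one with $e_1=\partial/\partial x$; in it one writes $\hat e_2=a\,\partial_x+b\,\partial_y$, and coordinates are taken with $b>0$. Here $\int 2\alpha\,dx$ denotes a fixed anti-derivative of $2\alpha$ with respect to $x$ (the same in all formulas), and $\int H\alpha e^{\int 2\alpha dx}dx$ a fixed anti-derivative with respect to $x$ of $H\alpha e^{\int 2\alpha dx}$ (the same in all formulas). *)

theory Defs
  imports "HOL-Analysis.Analysis"
begin

section \<open>Smooth maps\<close>

primrec higher_differentiable_on ::
    "nat \<Rightarrow> 'a::real_normed_vector set \<Rightarrow> ('a \<Rightarrow> 'b::real_normed_vector) \<Rightarrow> bool" where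
  "higher_differentiable_on 0 S f \<longleftrightarrow> continuous_on S f"
| "higher_differentiable_on (Suc n) S f \<longleftrightarrow>
     (\<forall>x\<in>S. f differentiable (at x)) \<and>
     (\<forall>v. higher_differentiable_on n S (\<lambda>x. frechet_derivative f (at x) v))"

text \<open>Meant for open sets \<open>S\<close>, in finite dimension, where it is the usual class of
  \<open>C\<^sup>\<infinity>\<close> maps on \<open>S\<close>.\<close>

definition smooth_on ::
    "'a::real_normed_vector set \<Rightarrow> ('a \<Rightarrow> 'b::real_normed_vector) \<Rightarrow> bool" where
  "smooth_on S f \<longleftrightarrow> (\<forall>n. higher_differentiable_on n S f)"

definition partial_x :: "(real \<times> real \<Rightarrow> 'b::real_normed_vector) \<Rightarrow> real \<times> real \<Rightarrow> 'b" where
  "partial_x f u = frechet_derivative f (at u) (1, 0)"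

definition partial_y :: "(real \<times> real \<Rightarrow> 'b::real_normed_vector) \<Rightarrow> real \<times> real \<Rightarrow> 'b" where
  "partial_y f u = frechet_derivative f (at u) (0, 1)"


section \<open>The Heisenberg group and its pseudohermitian structure\<close>

text \<open>Points and tangent vectors of \<open>H\<^sub>1\<close> are both elements of \<open>\<real>\<^sup>3\<close>, the latter with respect to
  the basis \<open>\<partial>\<^sub>x, \<partial>\<^sub>y, \<partial>\<^sub>z\<close>.\<close>

type_synonym heis = "real \<times> real \<times> real"

definition heis_mult :: "heis \<Rightarrow> heis \<Rightarrow> heis" where
  "heis_mult = (\<lambda>(x1, y1, z1) (x2, y2, z2). (x1 + x2, y1 + y2, z1 + z2 + y1 * x2 - x1 * y2))"

definition std_e1 :: "heis \<Rightarrow> heis" where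
  "std_e1 = (\<lambda>(x, y, z). (1, 0, y))"

definition std_e2 :: "heis \<Rightarrow> heis" where
  "std_e2 = (\<lambda>(x, y, z). (0, 1, - x))"

definition reeb :: heis where
  "reeb = (0, 0, 1)"

definition contact_form :: "heis \<Rightarrow> heis \<Rightarrow> real" where
  "contact_form = (\<lambda>(x, y, z) (v1, v2, v3). v3 + x * v2 - y * v1)"

definition contact_plane :: "heis \<Rightarrow> heis set" where
  "contact_plane p = {v. contact_form p v = 0}"

definition from_frame :: "heis \<Rightarrow> real \<times> real \<times> real \<Rightarrow> heis" where
  "from_frame p = (\<lambda>(a, b, c). a *\<^sub>R std_e1 p + b *\<^sub>R std_e2 p + c *\<^sub>R reeb)"

text \<open>Components of a tangent vector at \<open>p\<close> in the left invariant frame; the dual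
  coframe is \<open>dx, dy, \<Theta>\<close>.\<close>

definition frame_coords :: "heis \<Rightarrow> heis \<Rightarrow> real \<times> real \<times> real" where
  "frame_coords p v = (fst v, fst (snd v), contact_form p v)"

lemma from_frame_frame_coords: "from_frame p (frame_coords p v) = v"
  by (cases p; cases v)
    (simp add: from_frame_def frame_coords_def std_e1_def std_e2_def reeb_def
      contact_form_def algebra_simps)

lemma frame_coords_from_frame: "frame_coords p (from_frame p w) = w"
  by (cases p; cases w)
    (simp add: from_frame_def frame_coords_def std_e1_def std_e2_def reeb_def
      contact_form_def algebra_simps)

lemma left_invariant_frame:
  "(heis_mult q has_derivative (\<lambda>v. from_frame (heis_mult q p) (frame_coords p v))) (at p)"
proof -
  obtain a b c where q: "q = (a, b, c)" by (cases q)
  have 1: "heis_mult q = (\<lambda>p. (a + fst p, b + fst (snd p), c + snd (snd p) + b * fst p - a * fst (snd p)))"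
    by (auto simp: heis_mult_def q fun_eq_iff)
  have "(heis_mult q has_derivative
      (\<lambda>v. (fst v, fst (snd v), snd (snd v) + b * fst v - a * fst (snd v)))) (at p)"
    unfolding 1 by (auto intro!: derivative_eq_intros)
  also have "(\<lambda>v. (fst v, fst (snd v), snd (snd v) + b * fst v - a * fst (snd v))) =
      (\<lambda>v. from_frame (heis_mult q p) (frame_coords p v))"
    by (cases p) (auto simp: q fun_eq_iff heis_mult_def from_frame_def frame_coords_def
        std_e1_def std_e2_def reeb_def contact_form_def algebra_simps)
  finally show ?thesis .
qed

definition adapted_metric :: "heis \<Rightarrow> heis \<Rightarrow> heis \<Rightarrow> real" where
  "adapted_metric p v w = frame_coords p v \<bullet> frame_coords p w"

text \<open>Only used on the contact bundle.\<close>

definition heis_J :: "heis \<Rightarrow> heis \<Rightarrow> heis" where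
  "heis_J p v = (case frame_coords p v of (a, b, c) \<Rightarrow> a *\<^sub>R std_e2 p - b *\<^sub>R std_e1 p)"

definition heis_rigid_motion :: "(heis \<Rightarrow> heis) \<Rightarrow> bool" where
  "heis_rigid_motion \<Phi> \<longleftrightarrow>
     bij \<Phi> \<and> smooth_on UNIV \<Phi> \<and> smooth_on UNIV (inv \<Phi>) \<and>
     (\<forall>p v. contact_form (\<Phi> p) (frechet_derivative \<Phi> (at p) v) = contact_form p v) \<and>
     (\<forall>p. \<forall>v\<in>contact_plane p.
        frechet_derivative \<Phi> (at p) (heis_J p v) = heis_J (\<Phi> p) (frechet_derivative \<Phi> (at p) v))"


section \<open>Surfaces\<close>

definition smooth_embedding :: "(real \<times> real) set \<Rightarrow> (real \<times> real \<Rightarrow> heis) \<Rightarrow> bool" where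
  "smooth_embedding U X \<longleftrightarrow>
     open U \<and> smooth_on U X \<and> (\<forall>u\<in>U. inj (frechet_derivative X (at u))) \<and>
     (\<exists>Y. homeomorphism U (X ` U) X Y)"

definition local_parametrization ::
    "heis set \<Rightarrow> (real \<times> real) set \<Rightarrow> (real \<times> real \<Rightarrow> heis) \<Rightarrow> bool" where
  "local_parametrization S U X \<longleftrightarrow>
     smooth_embedding U X \<and> openin (top_of_set S) (X ` U)"

definition smooth_surface :: "heis set \<Rightarrow> bool" where
  "smooth_surface S \<longleftrightarrow> (\<forall>p\<in>S. \<exists>U X. local_parametrization S U X \<and> p \<in> X ` U)"

text \<open>Changes of parametrization being diffeomorphisms, one parametrization around each
  point suffices.\<close>

definition smooth_on_surface :: "heis set \<Rightarrow> (heis \<Rightarrow> 'b::real_normed_vector) \<Rightarrow> bool" where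
  "smooth_on_surface S f \<longleftrightarrow>
     (\<forall>p\<in>S. \<exists>U X. local_parametrization S U X \<and> p \<in> X ` U \<and> smooth_on U (\<lambda>u. f (X u)))"

definition tangent_space :: "heis set \<Rightarrow> heis \<Rightarrow> heis set" where
  "tangent_space S p =
     {v. \<exists>\<gamma> \<epsilon>. \<epsilon> > 0 \<and> smooth_on {-\<epsilon><..<\<epsilon>} \<gamma> \<and> \<gamma> ` {-\<epsilon><..<\<epsilon>} \<subseteq> S \<and>
          \<gamma> 0 = p \<and> (\<gamma> has_vector_derivative v) (at (0::real))}"

definition singular_point :: "heis set \<Rightarrow> heis \<Rightarrow> bool" where
  "singular_point S p \<longleftrightarrow> p \<in> S \<and> tangent_space S p = contact_plane p"

definition regular_surface :: "heis set \<Rightarrow> bool" where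
  "regular_surface S \<longleftrightarrow> smooth_surface S \<and> (\<nexists>p. singular_point S p)"

text \<open>\<open>\<nabla>\<^sub>v V = w\<close> at \<open>p\<close>, for a vector field \<open>V\<close> of \<open>H\<^sub>1\<close> defined along \<open>S\<close> and \<open>v\<close> tangent
  to \<open>S\<close>: the left invariant frame is parallel, so the frame components of \<open>V\<close> are
  differentiated.  A derivative \<open>D\<close> at \<open>p\<close> within \<open>S\<close> is not unique, but its values on vectors
  tangent to \<open>S\<close> are.\<close>

definition has_covariant_derivative ::
    "heis set \<Rightarrow> (heis \<Rightarrow> heis) \<Rightarrow> heis \<Rightarrow> heis \<Rightarrow> heis \<Rightarrow> bool" where
  "has_covariant_derivative S V p v w \<longleftrightarrow>
     (\<exists>D. ((\<lambda>q. frame_coords q (V q)) has_derivative D) (at p within S) \<and>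
          w = from_frame p (D v))"

text \<open>A choice \<open>E\<close> of the field \<open>e\<^sub>1\<close>. The two choices of sign change the signs of both the
  p-mean curvature and the \<open>\<alpha>\<close>-function, so these notions take \<open>E\<close> as an argument.\<close>

definition characteristic_field :: "heis set \<Rightarrow> (heis \<Rightarrow> heis) \<Rightarrow> bool" where
  "characteristic_field S E \<longleftrightarrow>
     smooth_on_surface S E \<and>
     (\<forall>p\<in>S. E p \<in> tangent_space S p \<inter> contact_plane p \<and> adapted_metric p (E p) (E p) = 1)"

definition p_mean_curvature :: "heis set \<Rightarrow> (heis \<Rightarrow> heis) \<Rightarrow> (heis \<Rightarrow> real) \<Rightarrow> bool" where
  "p_mean_curvature S E H \<longleftrightarrow>
     (\<forall>p\<in>S. has_covariant_derivative S (\<lambda>q. heis_J q (E q)) p (E p) (- (H p *\<^sub>R E p)))"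

definition alpha_function :: "heis set \<Rightarrow> (heis \<Rightarrow> heis) \<Rightarrow> (heis \<Rightarrow> real) \<Rightarrow> bool" where
  "alpha_function S E \<alpha> \<longleftrightarrow>
     (\<forall>p\<in>S. \<alpha> p *\<^sub>R heis_J p (E p) + reeb \<in> tangent_space S p)"

definition e2_hat :: "(heis \<Rightarrow> heis) \<Rightarrow> (heis \<Rightarrow> real) \<Rightarrow> heis \<Rightarrow> heis" where
  "e2_hat E \<alpha> p = (1 / sqrt (1 + (\<alpha> p)\<^sup>2)) *\<^sub>R (\<alpha> p *\<^sub>R heis_J p (E p) + reeb)"

text \<open>A coordinate system is given by its inverse chart \<open>X\<close>, so that the coordinate fields
  are the partial derivatives of \<open>X\<close>.\<close>

definition compatible_coordinates ::
    "heis set \<Rightarrow> (heis \<Rightarrow> heis) \<Rightarrow> (heis \<Rightarrow> real) \<Rightarrow> (real \<times> real) set \<Rightarrow>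
     (real \<times> real \<Rightarrow> heis) \<Rightarrow> bool" where
  "compatible_coordinates S E \<alpha> U X \<longleftrightarrow>
     local_parametrization S U X \<and>
     (\<forall>u\<in>U. partial_x X u = E (X u) \<and>
        (\<exists>a b. b > 0 \<and> e2_hat E \<alpha> (X u) = a *\<^sub>R partial_x X u + b *\<^sub>R partial_y X u))"


section \<open>The Codazzi-like equation and the integrability condition\<close>

definition codazzi_lienard :: "real \<Rightarrow> (real \<times> real) set \<Rightarrow> (real \<times> real \<Rightarrow> real) \<Rightarrow> bool" where
  "codazzi_lienard c U \<alpha> \<longleftrightarrow>
     (\<forall>u\<in>U. partial_x (partial_x \<alpha>) u + 6 * \<alpha> u * partial_x \<alpha> u + 4 * (\<alpha> u)^3 + c\<^sup>2 * \<alpha> u = 0)"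

text \<open>\<open>P\<close> stands for the chosen \<open>\<integral>2\<alpha> dx\<close>, and \<open>Q\<close> for the chosen
  \<open>\<integral>H\<alpha>e\<^bsup>\<integral>2\<alpha>dx\<^esup> dx\<close>.\<close>

definition fixed_antiderivatives ::
    "(real \<times> real) set \<Rightarrow> (real \<times> real \<Rightarrow> real) \<Rightarrow> (real \<times> real \<Rightarrow> real) \<Rightarrow>
     (real \<times> real \<Rightarrow> real) \<Rightarrow> (real \<times> real \<Rightarrow> real) \<Rightarrow> bool" where
  "fixed_antiderivatives U \<alpha> H P Q \<longleftrightarrow>
     smooth_on U P \<and> (\<forall>u\<in>U. partial_x P u = 2 * \<alpha> u) \<and>
     smooth_on U Q \<and> (\<forall>u\<in>U. partial_x Q u = H u * \<alpha> u * exp (P u))"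

definition integrability_condition ::
    "(real \<times> real) set \<Rightarrow> (real \<times> real \<Rightarrow> real) \<Rightarrow> (real \<times> real \<Rightarrow> real) \<Rightarrow>
     (real \<times> real \<Rightarrow> real) \<Rightarrow> (real \<times> real \<Rightarrow> real) \<Rightarrow> (real \<Rightarrow> real) \<Rightarrow> (real \<Rightarrow> real) \<Rightarrow> bool" where
  "integrability_condition U \<alpha> H P Q k h \<longleftrightarrow>
     (\<forall>u\<in>U. (h (snd u) - Q u) * partial_x H u + exp (k (snd u)) * partial_y H u =
        exp (P u) * (partial_x (partial_x \<alpha>) u + 6 * \<alpha> u * partial_x \<alpha> u + 4 * (\<alpha> u)^3
                     + \<alpha> u * (H u)\<^sup>2))"

definition coeff_b ::
    "(real \<times> real \<Rightarrow> real) \<Rightarrow> (real \<times> real \<Rightarrow> real) \<Rightarrow> (real \<Rightarrow> real) \<Rightarrow> real \<times> real \<Rightarrow> real" where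
  "coeff_b \<alpha> P k u = exp (k (snd u)) * (exp (- P u) / sqrt (1 + (\<alpha> u)\<^sup>2))"

definition coeff_a ::
    "(real \<times> real \<Rightarrow> real) \<Rightarrow> (real \<times> real \<Rightarrow> real) \<Rightarrow> (real \<times> real \<Rightarrow> real) \<Rightarrow> (real \<Rightarrow> real) \<Rightarrow>
     real \<times> real \<Rightarrow> real" where
  "coeff_a \<alpha> P Q h u = (exp (- P u) / sqrt (1 + (\<alpha> u)\<^sup>2)) * (h (snd u) - Q u)"


section \<open>Surfaces with prescribed invariants\<close>

text \<open>A function on the coordinate domain, viewed as a function on the surface \<open>X ` V\<close>.\<close>

definition on_surface ::
    "(real \<times> real) set \<Rightarrow> (real \<times> real \<Rightarrow> heis) \<Rightarrow> (real \<times> real \<Rightarrow> real) \<Rightarrow> heis \<Rightarrow> real" where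
  "on_surface V X f p = f (the_inv_into V X p)"

definition embedding_with_invariants ::
    "(real \<times> real) set \<Rightarrow> (real \<times> real \<Rightarrow> heis) \<Rightarrow> (heis \<Rightarrow> heis) \<Rightarrow>
     (real \<times> real \<Rightarrow> real) \<Rightarrow> (real \<times> real \<Rightarrow> real) \<Rightarrow> bool" where
  "embedding_with_invariants V X E \<alpha> H \<longleftrightarrow>
     smooth_embedding V X \<and> regular_surface (X ` V) \<and> characteristic_field (X ` V) E \<and>
     p_mean_curvature (X ` V) E (on_surface V X H) \<and>
     alpha_function (X ` V) E (on_surface V X \<alpha>) \<and>
     (\<forall>u\<in>V. E (X u) = partial_x X u)"

definition embedding_with_frame ::
    "(real \<times> real) set \<Rightarrow> (real \<times> real \<Rightarrow> heis) \<Rightarrow> (real \<times> real \<Rightarrow> real) \<Rightarrow> (real \<times> real \<Rightarrow> real) \<Rightarrow>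
     (real \<times> real \<Rightarrow> real) \<Rightarrow> (real \<times> real \<Rightarrow> real) \<Rightarrow> bool" where
  "embedding_with_frame V X \<alpha> H a b \<longleftrightarrow>
     (\<exists>E. embedding_with_invariants V X E \<alpha> H \<and>
        (\<forall>u\<in>V. e2_hat E (on_surface V X \<alpha>) (X u) = a u *\<^sub>R partial_x X u + b u *\<^sub>R partial_y X u))"

end

theory Submission
  imports Defs
begin

text \<open>Let \<open>c = cos \<theta>\<close> and \<open>s = sin \<theta>\<close> be the components of \<open>X\<^sub>x = e\<^sub>1\<close> in the left invariant frame,
  and write \<open>X\<^sub>y = r e\<^sub>1 + p J e\<^sub>1 + q T\<close>.  The p-mean curvature is \<open>H = \<theta>\<^sub>x\<close>, and equality of
  mixed partial derivatives of \<open>X\<close> amounts to \<open>r\<^sub>x = H p\<close>, \<open>q\<^sub>x = 2 p\<close> and \<open>\<theta>\<^sub>y = p\<^sub>x + H r\<close>, so that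
  \<open>X\<close> exists locally iff also \<open>H\<^sub>y = (p\<^sub>x + H r)\<^sub>x\<close>.  Here \<open>\<alpha> = p / q\<close>.  For constant \<open>H\<close> the last
  equation is \<open>p\<^sub>x\<^sub>x + H\<^sup>2 p = 0\<close>, which becomes the Codazzi-like equation on substituting \<open>p = \<alpha> q\<close>.
  Conversely the prescribed \<open>a\<close> and \<open>b\<close> mean \<open>q = exp (P - k)\<close>, \<open>p = \<alpha> q\<close> and
  \<open>r = - exp (- k) (h - Q)\<close>, for which \<open>H\<^sub>y = (p\<^sub>x + H r)\<^sub>x\<close> is the integrability condition.
  Two surfaces with the same \<open>p\<close>, \<open>q\<close>, \<open>r\<close>, \<open>H\<close> have angles differing by a constant, hence differ by a
  rotation about the vertical axis and a left translation.\<close>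

section \<open>Smooth maps\<close>

text \<open>A smooth angle \<theta> exists only locally, since \<open>U\<close> need not be simply
  connected. A given surface is therefore described by \<open>c\<close> and \<open>s\<close>, which
  are smooth on all of \<open>U\<close>; an angle is chosen only when a surface is constructed, and
  two surfaces are compared through the cosine and sine of the difference of their angles. The link
  with \<open>a\<close>, \<open>b\<close> and \<alpha> is the decomposition of \<open>e2_hat\<close>
  as \<open>a X_x + b X_y\<close>: its components along \<open>e_1\<close>, \<open>J e_1\<close> and
  \<open>T\<close> read \<open>a + b r = 0\<close>,
  \<open>b p = \<alpha> / sqrt (1 + \<alpha>\<^sup>2)\<close> and
  \<open>b q = 1 / sqrt (1 + \<alpha>\<^sup>2)\<close>. So \<open>b > 0\<close> makes
  \<open>q\<close> positive, \<alpha> is smooth in part (A) because it is \<open>p / q\<close>, and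
  in part (B) the data determine \<open>p\<close>, \<open>q\<close> and \<open>r\<close>. The factor
  2 in \<open>q_x = 2 p\<close>, hence the coefficients 6 and 4 of the equation, comes from the
  bracket of the two horizontal left invariant fields, which is \<open>-2 T\<close>. The domain
  shrinks in part (B) because closed one-forms are integrated on rectangles and an immersion is
  injective only near a point.\<close>

lemma higher_differentiable_on_cong:
  assumes "open S" "\<And>x. x \<in> S \<Longrightarrow> f x = g x" "higher_differentiable_on n S f"
  shows "higher_differentiable_on n S g"
  using assms(2,3)
proof (induction n arbitrary: f g)
  case 0
  then show ?case using continuous_on_cong[of S S f g] by simp
next
  case (Suc n)
  have "frechet_derivative f (at x) v = frechet_derivative g (at x) v" if "x \<in> S" for x v
    using frechet_derivative_transform_within_open[of f x S g] Suc.prems assms(1) that by simp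
  moreover have "g differentiable (at x)" if "x \<in> S" for x
    using Suc.prems assms(1) that by (meson differentiable_def has_derivative_transform_within_open
        higher_differentiable_on.simps(2))
  moreover have "higher_differentiable_on n S (\<lambda>x. frechet_derivative g (at x) v)" for v
    using Suc.IH[of "\<lambda>x. frechet_derivative f (at x) v" "\<lambda>x. frechet_derivative g (at x) v"]
      Suc.prems(2) calculation(1) by simp
  ultimately show ?case by simp
qed

lemma higher_differentiable_on_SucD:
  assumes "higher_differentiable_on (Suc n) S f"
  shows "higher_differentiable_on n S f"
  using assms
proof (induction n arbitrary: f)
  case 0
  then show ?case
    by (simp add: continuous_at_imp_continuous_on differentiable_imp_continuous_within)
next
  case (Suc n)
  then show ?case by (metis higher_differentiable_on.simps(2))
qed

text \<open>By uniqueness of derivatives, any explicit formula \<open>D\<close> may replace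
  \<open>frechet_derivative\<close> on an open set. The closure lemmas below exhibit such a
  \<open>D\<close> and apply their induction hypothesis to \<open>D x v\<close>.\<close>

lemma higher_differentiable_on_SucI:
  assumes "open S" "\<And>x. x \<in> S \<Longrightarrow> (f has_derivative D x) (at x)"
    "\<And>v. higher_differentiable_on n S (\<lambda>x. D x v)"
  shows "higher_differentiable_on (Suc n) S f"
proof -
  have "D x v = frechet_derivative f (at x) v" if "x \<in> S" for x v
    using assms(2)[OF that] frechet_derivative_at by metis
  then show ?thesis
    using assms higher_differentiable_on_cong[OF assms(1), of "\<lambda>x. D x v" for v]
    by (auto simp: differentiable_def)
qed

lemma higher_differentiable_on_has_derivative:
  assumes "higher_differentiable_on (Suc n) S f" "x \<in> S"
  shows "(f has_derivative frechet_derivative f (at x)) (at x)"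
  using assms by (simp add: frechet_derivative_works[symmetric])

lemma higher_differentiable_on_subset:
  "higher_differentiable_on n S f \<Longrightarrow> T \<subseteq> S \<Longrightarrow> higher_differentiable_on n T f"
  by (induction n arbitrary: f) (auto intro: continuous_on_subset)

lemma higher_differentiable_on_const: "higher_differentiable_on n S (\<lambda>x. c)"
  by (induction n arbitrary: c) auto

lemma higher_differentiable_on_linear:
  assumes "bounded_linear L" "open S"
  shows "higher_differentiable_on n S L"
proof (cases n)
  case 0
  then show ?thesis using assms linear_continuous_on by auto
next
  case (Suc m)
  then show ?thesis
    using assms bounded_linear_imp_has_derivative higher_differentiable_on_const
      higher_differentiable_on_SucI[of S L "\<lambda>x. L" m] by blast
qed

lemma higher_differentiable_on_add:
  fixes f g :: "'a::real_normed_vector \<Rightarrow> 'b::real_normed_vector"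
  assumes "open S" "higher_differentiable_on n S f" "higher_differentiable_on n S g"
  shows "higher_differentiable_on n S (\<lambda>x. f x + g x)"
  using assms(2,3)
proof (induction n arbitrary: f g)
  case (Suc n)
  show ?case
  proof (rule higher_differentiable_on_SucI[OF assms(1)])
    show "((\<lambda>x. f x + g x) has_derivative
        (\<lambda>v. frechet_derivative f (at x) v + frechet_derivative g (at x) v)) (at x)" if "x \<in> S" for x
      using Suc.prems that by (intro derivative_intros higher_differentiable_on_has_derivative)
  qed (use Suc in auto)
qed (auto intro: continuous_intros)

text \<open>Each term of the product rule pairs a differentiated factor with an undifferentiated
  one. The latter is lowered by one order with \<open>higher_differentiable_on_SucD\<close>, and the
  induction runs over arbitrary \<open>f\<close> and \<open>g\<close>.\<close>

lemma higher_differentiable_on_bilinear: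
  fixes f :: "'a::real_normed_vector \<Rightarrow> 'b::real_normed_vector"
    and g :: "'a \<Rightarrow> 'c::real_normed_vector"
  assumes "bounded_bilinear b" "open S" "higher_differentiable_on n S f" "higher_differentiable_on n S g"
  shows "higher_differentiable_on n S (\<lambda>x. b (f x) (g x))"
  using assms(3,4)
proof (induction n arbitrary: f g)
  case 0
  then show ?case using bounded_bilinear.continuous_on[OF assms(1)] by auto
next
  case (Suc n)
  show ?case
  proof (rule higher_differentiable_on_SucI[OF assms(2)])
    show "((\<lambda>x. b (f x) (g x)) has_derivative
        (\<lambda>v. b (f x) (frechet_derivative g (at x) v) + b (frechet_derivative f (at x) v) (g x))) (at x)"
      if "x \<in> S" for x
      using Suc.prems that
      by (intro bounded_bilinear.FDERIV[OF assms(1)] higher_differentiable_on_has_derivative)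
    fix v
    show "higher_differentiable_on n S
      (\<lambda>x. b (f x) (frechet_derivative g (at x) v) + b (frechet_derivative f (at x) v) (g x))"
      using Suc.prems higher_differentiable_on_SucD[OF Suc.prems(1)] higher_differentiable_on_SucD[OF Suc.prems(2)]
      by (intro higher_differentiable_on_add[OF assms(2)] Suc.IH) auto
  qed
qed

lemma higher_differentiable_on_Pair:
  assumes "open S" "higher_differentiable_on n S f" "higher_differentiable_on n S g"
  shows "higher_differentiable_on n S (\<lambda>x. (f x, g x))"
  using assms(2,3)
proof (induction n arbitrary: f g)
  case (Suc n)
  show ?case
  proof (rule higher_differentiable_on_SucI[OF assms(1)])
    show "((\<lambda>x. (f x, g x)) has_derivative
        (\<lambda>v. (frechet_derivative f (at x) v, frechet_derivative g (at x) v))) (at x)" if "x \<in> S" for x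
      using Suc.prems that by (intro derivative_intros higher_differentiable_on_has_derivative)
  qed (use Suc in auto)
qed (auto intro: continuous_intros)

lemma higher_differentiable_on_linear_comp:
  fixes f :: "'a::real_normed_vector \<Rightarrow> 'b::real_normed_vector"
  assumes "bounded_linear L" "open S" "higher_differentiable_on n S f"
  shows "higher_differentiable_on n S (\<lambda>x. L (f x))"
  using assms(3)
proof (induction n arbitrary: f)
  case 0
  then show ?case
    by (auto intro: bounded_linear.continuous_on[OF assms(1)])
next
  case (Suc n)
  show ?case
  proof (rule higher_differentiable_on_SucI[OF assms(2)])
    show "((\<lambda>x. L (f x)) has_derivative (\<lambda>v. L (frechet_derivative f (at x) v))) (at x)"
      if "x \<in> S" for x
      using Suc.prems that
      by (intro bounded_linear.has_derivative[OF assms(1)] higher_differentiable_on_has_derivative)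
  qed (use Suc in auto)
qed

text \<open>In general both the base point and the direction of the derivative of \<open>g\<close>
  at \<open>f x\<close> would vary with \<open>x\<close>. For \<open>g\<close> on the reals,
  linearity splits off the direction as a scalar factor, leaving a product of an
  \<open>f\<close>-derivative with a composite covered by the induction hypothesis.\<close>

lemma higher_differentiable_on_real_comp:
  fixes f :: "'a::real_normed_vector \<Rightarrow> real" and g :: "real \<Rightarrow> real"
  assumes "open S" "open T" "f ` S \<subseteq> T"
    "higher_differentiable_on n S f" "higher_differentiable_on n T g"
  shows "higher_differentiable_on n S (\<lambda>x. g (f x))"
  using assms(4,5)
proof (induction n arbitrary: g)
  case 0
  then show ?case using assms(3) continuous_on_compose2[of T g S f] by simp
next
  case (Suc n)
  show ?case
  proof (rule higher_differentiable_on_SucI[OF assms(1)])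
    fix x assume x: "x \<in> S"
    have g: "(g has_derivative frechet_derivative g (at (f x))) (at (f x))"
      using Suc.prems(2) x assms(3) by (intro higher_differentiable_on_has_derivative) auto
    define m where "m = frechet_derivative g (at (f x)) 1"
    have "frechet_derivative g (at (f x)) w = w * m" for w
      using linear_cmul[OF has_derivative_linear[OF g], of w 1] by (simp add: m_def)
    then have "frechet_derivative g (at (f x)) = (\<lambda>w. w * m)" by (rule ext)
    with g have "(g has_derivative (\<lambda>w. w * m)) (at (f x))" by simp
    then show "((\<lambda>x. g (f x)) has_derivative
        (\<lambda>v. frechet_derivative f (at x) v * frechet_derivative g (at (f x)) 1)) (at x)"
      unfolding m_def[symmetric]
      by (rule has_derivative_compose[OF higher_differentiable_on_has_derivative[OF Suc.prems(1) x]])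
  next
    fix v
    show "higher_differentiable_on n S
      (\<lambda>x. frechet_derivative f (at x) v * frechet_derivative g (at (f x)) 1)"
      using Suc.prems higher_differentiable_on_SucD[OF Suc.prems(1)]
      by (intro higher_differentiable_on_bilinear[OF bounded_bilinear_mult assms(1)]
          Suc.IH[of "\<lambda>x. frechet_derivative g (at x) 1"]) auto
  qed
qed

text \<open>The direction \<open>L v\<close> in which \<open>f\<close> gets differentiated is the
  same at every point, so the induction hypothesis applies to that directional derivative of
  \<open>f\<close>. This makes the images of straight lines under a parametrization smooth
  curves.\<close>

lemma higher_differentiable_on_affine_comp:
  fixes f :: "'a::real_normed_vector \<Rightarrow> 'b::real_normed_vector"
    and L :: "'c::real_normed_vector \<Rightarrow> 'a"
  assumes "open S" "bounded_linear L" "\<And>x. x \<in> S \<Longrightarrow> b + L x \<in> T"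
    "higher_differentiable_on n T f"
  shows "higher_differentiable_on n S (\<lambda>x. f (b + L x))"
  using assms(4)
proof (induction n arbitrary: f)
  case 0
  then show ?case using assms(3)
    by (auto intro!: continuous_on_compose2[of T f S] continuous_intros
        bounded_linear.continuous_on[OF assms(2)])
next
  case (Suc n)
  show ?case
  proof (rule higher_differentiable_on_SucI[OF assms(1)])
    fix x assume x: "x \<in> S"
    have "((\<lambda>x. b + L x) has_derivative (\<lambda>v. 0 + L v)) (at x)"
      by (intro derivative_intros bounded_linear.has_derivative[OF assms(2)])
    then have *: "((\<lambda>x. b + L x) has_derivative L) (at x)" by simp
    show "((\<lambda>x. f (b + L x)) has_derivative (\<lambda>v. frechet_derivative f (at (b + L x)) (L v))) (at x)"
      by (rule has_derivative_compose[OF * higher_differentiable_on_has_derivative[OF Suc.prems]])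
        (use assms x in auto)
  qed (use Suc in auto)
qed

section \<open>Smooth maps: passage to all orders\<close>

lemma smooth_on_cong:
  "open S \<Longrightarrow> (\<And>x. x \<in> S \<Longrightarrow> f x = g x) \<Longrightarrow> smooth_on S f \<Longrightarrow> smooth_on S g"
  using higher_differentiable_on_cong smooth_on_def by metis

lemma smooth_on_subset: "smooth_on S f \<Longrightarrow> T \<subseteq> S \<Longrightarrow> smooth_on T f"
  using higher_differentiable_on_subset smooth_on_def by metis

lemma smooth_on_has_derivative:
  "smooth_on S f \<Longrightarrow> x \<in> S \<Longrightarrow> (f has_derivative frechet_derivative f (at x)) (at x)"
  using higher_differentiable_on_has_derivative smooth_on_def by metis

lemma smooth_on_continuous_on: "smooth_on S f \<Longrightarrow> continuous_on S f"
  using higher_differentiable_on.simps(1) smooth_on_def by metis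

lemma smooth_on_derivative: "smooth_on S f \<Longrightarrow> smooth_on S (\<lambda>x. frechet_derivative f (at x) v)"
  using higher_differentiable_on.simps(2) smooth_on_def by metis

lemma smooth_on_partial: "smooth_on S f \<Longrightarrow> smooth_on S (partial_x f)"
    "smooth_on S f \<Longrightarrow> smooth_on S (partial_y f)"
  using smooth_on_derivative[of S f "(1,0)"] smooth_on_derivative[of S f "(0,1)"]
  by (simp_all add: partial_x_def[abs_def] partial_y_def[abs_def])

lemma smooth_on_const: "smooth_on S (\<lambda>x. c)"
  by (simp add: smooth_on_def higher_differentiable_on_const)

lemma smooth_on_linear: "bounded_linear L \<Longrightarrow> open S \<Longrightarrow> smooth_on S L"
  by (simp add: smooth_on_def higher_differentiable_on_linear)

lemma smooth_on_linear_comp: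
  "bounded_linear L \<Longrightarrow> open S \<Longrightarrow> smooth_on S f \<Longrightarrow> smooth_on S (\<lambda>x. L (f x))"
  by (simp add: smooth_on_def higher_differentiable_on_linear_comp)

lemma smooth_on_add: "open S \<Longrightarrow> smooth_on S f \<Longrightarrow> smooth_on S g \<Longrightarrow> smooth_on S (\<lambda>x. f x + g x)"
  by (simp add: smooth_on_def higher_differentiable_on_add)

lemma smooth_on_minus: "open S \<Longrightarrow> smooth_on S f \<Longrightarrow> smooth_on S (\<lambda>x. - f x)"
  using smooth_on_linear_comp[OF bounded_linear_minus[OF bounded_linear_ident]] by blast

lemma smooth_on_diff: "open S \<Longrightarrow> smooth_on S f \<Longrightarrow> smooth_on S g \<Longrightarrow> smooth_on S (\<lambda>x. f x - g x)"
  using smooth_on_add[of S f "\<lambda>x. - g x"] smooth_on_minus[of S g] by simp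

lemma smooth_on_mult:
  fixes f g :: "'a::real_normed_vector \<Rightarrow> real"
  shows "open S \<Longrightarrow> smooth_on S f \<Longrightarrow> smooth_on S g \<Longrightarrow> smooth_on S (\<lambda>x. f x * g x)"
  by (simp add: smooth_on_def higher_differentiable_on_bilinear[OF bounded_bilinear_mult])

lemma smooth_on_Pair: "open S \<Longrightarrow> smooth_on S f \<Longrightarrow> smooth_on S g \<Longrightarrow> smooth_on S (\<lambda>x. (f x, g x))"
  by (simp add: smooth_on_def higher_differentiable_on_Pair)

lemma smooth_on_real_comp:
  fixes f :: "'a::real_normed_vector \<Rightarrow> real" and g :: "real \<Rightarrow> real"
  shows "smooth_on T g \<Longrightarrow> open S \<Longrightarrow> open T \<Longrightarrow> f ` S \<subseteq> T \<Longrightarrow> smooth_on S f \<Longrightarrow> smooth_on S (\<lambda>x. g (f x))"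
  by (simp add: smooth_on_def higher_differentiable_on_real_comp)

lemma smooth_on_affine_comp:
  "open S \<Longrightarrow> bounded_linear L \<Longrightarrow> (\<And>x. x \<in> S \<Longrightarrow> b + L x \<in> T) \<Longrightarrow> smooth_on T f \<Longrightarrow>
    smooth_on S (\<lambda>x. f (b + L x))"
  unfolding smooth_on_def using higher_differentiable_on_affine_comp by blast

section \<open>Smoothness of elementary functions\<close>

lemma smooth_on_exp_real: "smooth_on UNIV (exp :: real \<Rightarrow> real)"
proof -
  have "higher_differentiable_on n UNIV (exp :: real \<Rightarrow> real)" for n
  proof (induction n)
    case (Suc n)
    show ?case
    proof (rule higher_differentiable_on_SucI)
      show "(exp has_derivative (\<lambda>v. v * exp x)) (at x)" for x :: real
        by (auto intro!: derivative_eq_intros)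
      show "higher_differentiable_on n UNIV (\<lambda>x. v * exp x)" for v :: real
        by (intro higher_differentiable_on_bilinear[OF bounded_bilinear_mult]
            higher_differentiable_on_const Suc open_UNIV)
    qed simp
  qed (auto intro: continuous_intros)
  then show ?thesis by (simp add: smooth_on_def)
qed

lemma smooth_on_sin_cos_real:
  "smooth_on UNIV (sin :: real \<Rightarrow> real)" "smooth_on UNIV (cos :: real \<Rightarrow> real)"
proof -
  have "higher_differentiable_on n UNIV (sin :: real \<Rightarrow> real) \<and>
    higher_differentiable_on n UNIV (cos :: real \<Rightarrow> real)" for n
  proof (induction n)
    case (Suc n)
    have *: "higher_differentiable_on n UNIV (\<lambda>x. v * sin x)"
        "higher_differentiable_on n UNIV (\<lambda>x. v * cos x)" for v :: real
      using Suc by (auto intro!: higher_differentiable_on_bilinear[OF bounded_bilinear_mult]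
          higher_differentiable_on_const)
    have "higher_differentiable_on (Suc n) UNIV (sin :: real \<Rightarrow> real)"
    proof (rule higher_differentiable_on_SucI[OF open_UNIV _ *(2)])
      show "(sin has_derivative (\<lambda>v. v * cos x)) (at x)" for x :: real
        by (auto intro!: derivative_eq_intros)
    qed
    moreover have "higher_differentiable_on (Suc n) UNIV (cos :: real \<Rightarrow> real)"
    proof (rule higher_differentiable_on_SucI[OF open_UNIV _ *(1)])
      show "(cos has_derivative (\<lambda>v. - v * sin x)) (at x)" for x :: real
        by (auto intro!: derivative_eq_intros)
    qed
    ultimately show ?case by simp
  qed (auto intro: continuous_intros)
  then show "smooth_on UNIV (sin :: real \<Rightarrow> real)" "smooth_on UNIV (cos :: real \<Rightarrow> real)"
    by (simp_all add: smooth_on_def)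
qed

lemma smooth_on_inverse_real: "smooth_on {0<..} (inverse :: real \<Rightarrow> real)"
proof -
  have "higher_differentiable_on n {0<..} (inverse :: real \<Rightarrow> real)" for n
  proof (induction n)
    case (Suc n)
    show ?case
    proof (rule higher_differentiable_on_SucI)
      show "(inverse has_derivative (\<lambda>v. - v * (inverse x * inverse x))) (at x)"
        if "x \<in> {0<..}" for x :: real
        using that by (auto intro!: derivative_eq_intros)
      show "higher_differentiable_on n {0<..} (\<lambda>x. - v * (inverse x * inverse x))" for v :: real
        by (intro higher_differentiable_on_bilinear[OF bounded_bilinear_mult]
            higher_differentiable_on_const Suc open_greaterThan)
    qed simp
  qed (auto intro!: continuous_intros)
  then show ?thesis by (simp add: smooth_on_def)
qed

lemmas smooth_on_exp = smooth_on_real_comp[OF smooth_on_exp_real _ open_UNIV subset_UNIV]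
lemmas smooth_on_sin = smooth_on_real_comp[OF smooth_on_sin_cos_real(1) _ open_UNIV subset_UNIV]
lemmas smooth_on_cos = smooth_on_real_comp[OF smooth_on_sin_cos_real(2) _ open_UNIV subset_UNIV]

lemmas smooth_on_intros = smooth_on_const smooth_on_add smooth_on_minus smooth_on_diff
  smooth_on_mult smooth_on_Pair smooth_on_exp smooth_on_sin smooth_on_cos smooth_on_partial


section \<open>Calculus of partial derivatives in the plane\<close>

lemma smooth_on_differentiable: "smooth_on S f \<Longrightarrow> x \<in> S \<Longrightarrow> f differentiable (at x)"
  using smooth_on_has_derivative differentiable_def by blast

lemma partial_eqI:
  assumes "(f has_derivative D) (at u)"
  shows "partial_x f u = D (1, 0)" "partial_y f u = D (0, 1)"
  using frechet_derivative_at[OF assms] by (simp_all add: partial_x_def partial_y_def)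

lemma differentiable_has_derivative_partials:
  assumes "f differentiable (at u)"
  shows "(f has_derivative (\<lambda>v. fst v *\<^sub>R partial_x f u + snd v *\<^sub>R partial_y f u)) (at u)"
proof -
  have D: "(f has_derivative frechet_derivative f (at u)) (at u)"
    using assms frechet_derivative_works by blast
  have "frechet_derivative f (at u) v = fst v *\<^sub>R partial_x f u + snd v *\<^sub>R partial_y f u" for v
  proof -
    interpret linear "frechet_derivative f (at u)" by (rule has_derivative_linear[OF D])
    have "v = fst v *\<^sub>R (1, 0) + snd v *\<^sub>R (0, 1)" by (cases v) simp
    then show ?thesis unfolding partial_x_def partial_y_def by (metis add scale)
  qed
  with D show ?thesis by (metis (no_types, lifting) ext)
qed

lemmas smooth_on_has_derivative_partials =
  differentiable_has_derivative_partials[OF smooth_on_differentiable]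

lemma partial_cong:
  assumes "open S" "u \<in> S" "\<And>x. x \<in> S \<Longrightarrow> f x = g x" "smooth_on S f"
  shows "partial_x f u = partial_x g u" "partial_y f u = partial_y g u"
  using frechet_derivative_transform_within_open[OF smooth_on_differentiable[OF assms(4,2)] assms(1,2), of g]
    assms(3)
  by (simp_all add: partial_x_def partial_y_def)

lemma partial_const [simp]: "partial_x (\<lambda>_. c) u = 0" "partial_y (\<lambda>_. c) u = 0"
  by (simp_all add: partial_x_def partial_y_def)

lemma partial_algebra:
  fixes f g :: "real \<times> real \<Rightarrow> real"
  assumes f: "f differentiable (at u)" and g: "g differentiable (at u)"
  shows "partial_x (\<lambda>u. f u + g u) u = partial_x f u + partial_x g u"
    "partial_y (\<lambda>u. f u + g u) u = partial_y f u + partial_y g u"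
    "partial_x (\<lambda>u. f u - g u) u = partial_x f u - partial_x g u"
    "partial_y (\<lambda>u. f u - g u) u = partial_y f u - partial_y g u"
    "partial_x (\<lambda>u. f u * g u) u = partial_x f u * g u + f u * partial_x g u"
    "partial_y (\<lambda>u. f u * g u) u = partial_y f u * g u + f u * partial_y g u"
proof -
  note D = differentiable_has_derivative_partials[OF f] differentiable_has_derivative_partials[OF g]
  note add = partial_eqI[OF has_derivative_add[OF D]]
  note diff = partial_eqI[OF has_derivative_diff[OF D]]
  note mult = partial_eqI[OF has_derivative_mult[OF D]]
  show "partial_x (\<lambda>u. f u + g u) u = partial_x f u + partial_x g u"
    "partial_y (\<lambda>u. f u + g u) u = partial_y f u + partial_y g u"
    "partial_x (\<lambda>u. f u - g u) u = partial_x f u - partial_x g u"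
    "partial_y (\<lambda>u. f u - g u) u = partial_y f u - partial_y g u"
    "partial_x (\<lambda>u. f u * g u) u = partial_x f u * g u + f u * partial_x g u"
    "partial_y (\<lambda>u. f u * g u) u = partial_y f u * g u + f u * partial_y g u"
    using add diff mult by simp_all
qed

lemma partial_minus:
  fixes f :: "real \<times> real \<Rightarrow> real"
  assumes f: "f differentiable (at u)"
  shows "partial_x (\<lambda>u. - f u) u = - partial_x f u" "partial_y (\<lambda>u. - f u) u = - partial_y f u"
  using partial_eqI[OF has_derivative_minus[OF differentiable_has_derivative_partials[OF f]]]
  by simp_all

lemma partial_real_comp:
  fixes f :: "real \<times> real \<Rightarrow> real"
  assumes f: "f differentiable (at u)" and g: "(g has_real_derivative g') (at (f u))"
  shows "partial_x (\<lambda>u. g (f u)) u = g' * partial_x f u" "partial_y (\<lambda>u. g (f u)) u = g' * partial_y f u"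
  using partial_eqI[OF has_derivative_compose[OF differentiable_has_derivative_partials[OF f]
        g[unfolded has_field_derivative_def]]]
  by simp_all

lemma partial_bounded_linear:
  assumes "bounded_linear L" "f differentiable (at u)"
  shows "partial_x (\<lambda>u. L (f u)) u = L (partial_x f u)" "partial_y (\<lambda>u. L (f u)) u = L (partial_y f u)"
  using partial_eqI[OF bounded_linear.has_derivative[OF assms(1)
        differentiable_has_derivative_partials[OF assms(2)]]] by simp_all

lemma partial_snd_comp:
  fixes g :: "real \<Rightarrow> real"
  assumes "g differentiable (at (snd u))"
  shows "partial_x (\<lambda>u. g (snd u)) u = 0"
proof -
  have g: "(g has_derivative frechet_derivative g (at (snd u))) (at (snd u))"
    using assms frechet_derivative_works by blast
  have "((\<lambda>u. g (snd u)) has_derivative (\<lambda>v. frechet_derivative g (at (snd u)) (snd v))) (at u)"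
    by (rule has_derivative_compose[OF has_derivative_snd[OF has_derivative_ident] g])
  from partial_eqI(1)[OF this] show ?thesis
    using linear_0[OF has_derivative_linear[OF g]] by simp
qed

lemma partial_x_slice:
  assumes "f differentiable (at (t, y))"
  shows "((\<lambda>t. f (t, y)) has_real_derivative partial_x f (t, y)) (at t)"
proof -
  have "((\<lambda>t. (t, y)) has_derivative (\<lambda>h. (h, 0))) (at t)"
    by (auto intro!: derivative_eq_intros)
  from has_derivative_compose[OF this differentiable_has_derivative_partials[OF assms]]
  show ?thesis by (simp add: has_field_derivative_def mult_commute_abs)
qed

lemma partial_y_slice:
  assumes "f differentiable (at (x, t))"
  shows "((\<lambda>t. f (x, t)) has_real_derivative partial_y f (x, t)) (at t)"
proof -
  have "((\<lambda>t. (x, t)) has_derivative (\<lambda>h. (0, h))) (at t)"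
    by (auto intro!: derivative_eq_intros)
  from has_derivative_compose[OF this differentiable_has_derivative_partials[OF assms]]
  show ?thesis by (simp add: has_field_derivative_def mult_commute_abs)
qed


section \<open>Antiderivatives in the plane\<close>

text \<open>The integral over an empty interval is 0, so this is an antiderivative only to the right
  of \<open>a\<close>.\<close>

definition antideriv_x :: "real \<Rightarrow> (real \<times> real \<Rightarrow> real) \<Rightarrow> real \<times> real \<Rightarrow> real" where
  "antideriv_x a f u = integral {a..fst u} (\<lambda>t. f (t, snd u))"

text \<open>The x-derivative comes from the fundamental theorem of calculus, the y-derivative from
  differentiation under the integral sign. As the former is continuous, the two combine to a total
  derivative.\<close>

lemma antideriv_x_has_derivative:
  assumes f: "smooth_on U f" and sub: "{a..b} \<times> {c..d} \<subseteq> U"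
    and x: "x \<in> {a<..<b}" and y: "y \<in> {c<..<d}"
  shows "(antideriv_x a f has_derivative
      (\<lambda>v. fst v * f (x, y) + snd v * antideriv_x a (partial_y f) (x, y))) (at (x, y))"
proof -
  let ?X = "{a<..<b}" and ?Y = "{c<..<d}"
  \<comment> \<open>The variables are swapped because \<open>has_derivative_partialsI\<close> asks
    for continuity of the partial derivative in the second variable, and the one known to be
    continuous at this point is \<open>f\<close>, the derivative in x.\<close>
  define G where "G = (\<lambda>y x. integral {a..x} (\<lambda>t. f (t, y)))"
  have cont: "continuous_on ({a..b} \<times> {c..d}) f"
    using smooth_on_continuous_on[OF f] sub continuous_on_subset by blast
  have cont': "continuous_on ({a..b} \<times> {c..d}) (partial_y f)"
    using smooth_on_continuous_on[OF smooth_on_partial(2)[OF f]] sub continuous_on_subset by blast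
  have slice: "continuous_on {a..b} (\<lambda>t. f (t, y'))" if "y' \<in> ?Y" for y'
    using that by (intro continuous_on_compose2[OF cont] continuous_intros) auto
  have 1: "((\<lambda>y. G y x) has_derivative (\<lambda>h. antideriv_x a (partial_y f) (x, y) * h)) (at y within ?Y)"
  proof -
    have "((\<lambda>y. integral (cbox a x) (\<lambda>t. f (t, y))) has_field_derivative
        integral (cbox a x) (\<lambda>t. partial_y f (t, y))) (at y within ?Y)"
    proof (rule leibniz_rule_field_derivative)
      fix y' t assume "y' \<in> ?Y" "t \<in> cbox a x"
      then have "(t, y') \<in> {a..b} \<times> {c..d}" using x by auto
      then have "(t, y') \<in> U" using sub by blast
      then show "((\<lambda>y. f (t, y)) has_real_derivative partial_y f (t, y')) (at y' within ?Y)"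
        by (rule has_field_derivative_at_within[OF partial_y_slice[OF smooth_on_differentiable[OF f]]])
    next
      fix y' assume "y' \<in> ?Y"
      then have "continuous_on (cbox a x) (\<lambda>t. f (t, y'))"
        using x by (intro continuous_on_subset[OF slice]) auto
      then show "(\<lambda>t. f (t, y')) integrable_on cbox a x" by (rule integrable_continuous)
    next
      have "continuous_on (?Y \<times> cbox a x) (\<lambda>p. partial_y f (snd p, fst p))"
        using x by (intro continuous_on_compose2[OF cont'] continuous_intros) auto
      then show "continuous_on (?Y \<times> cbox a x) (\<lambda>(y, t). partial_y f (t, y))"
        by (simp add: case_prod_beta')
    qed (use y in auto)
    then show ?thesis
      by (simp add: has_field_derivative_def G_def antideriv_x_def)
  qed
  have 2: "((\<lambda>x. G y' x) has_derivative blinfun_apply (blinfun_mult_right (f (x', y'))))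
      (at x' within ?X)" if "y' \<in> ?Y" "x' \<in> ?X" for x' y'
  proof -
    have "((\<lambda>x. integral {a..x} (\<lambda>t. f (t, y'))) has_real_derivative f (x', y')) (at x' within {a..b})"
      using that slice[OF that(1)] by (intro integral_has_real_derivative) auto
    then show ?thesis unfolding G_def
      by (auto simp: has_field_derivative_def intro: has_derivative_subset)
  qed
  have 3: "continuous (at (y, x) within ?Y \<times> ?X) (\<lambda>(y, x). blinfun_mult_right (f (x, y)))"
  proof -
    have "continuous_on (?Y \<times> ?X) (\<lambda>p. f (snd p, fst p))"
      by (intro continuous_on_compose2[OF cont] continuous_intros) auto
    then have "continuous_on (?Y \<times> ?X) (\<lambda>p. blinfun_mult_right (f (snd p, fst p)))"
      by (intro bounded_linear.continuous_on[OF bounded_linear_blinfun_mult_right])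
    then show ?thesis using x y by (simp add: continuous_on_eq_continuous_within case_prod_beta')
  qed
  have "((\<lambda>(y, x). G y x) has_derivative
     (\<lambda>(ty, tx). antideriv_x a (partial_y f) (x, y) * ty + blinfun_mult_right (f (x, y)) tx))
     (at (y, x) within ?Y \<times> ?X)"
    by (rule has_derivative_partialsI[OF 1 2 3]) (use x in auto)
  then have G: "((\<lambda>(y, x). G y x) has_derivative
     (\<lambda>(ty, tx). antideriv_x a (partial_y f) (x, y) * ty + f (x, y) * tx)) (at (y, x))"
  proof -
    have "at (y, x) within ?Y \<times> ?X = at (y, x)"
      using x y by (intro at_within_open open_Times) auto
    with \<open>((\<lambda>(y, x). G y x) has_derivative _) (at (y, x) within _)\<close> show ?thesis by simp
  qed
  have "((\<lambda>u. (snd u, fst u)) has_derivative (\<lambda>u. (snd u, fst u))) (at (x, y))"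
    by (auto intro!: derivative_eq_intros)
  moreover from G have "((\<lambda>p. G (fst p) (snd p)) has_derivative
     (\<lambda>p. antideriv_x a (partial_y f) (x, y) * fst p + f (x, y) * snd p)) (at (snd (x, y), fst (x, y)))"
    by (simp add: case_prod_beta')
  ultimately have "((\<lambda>u. G (fst (snd u, fst u)) (snd (snd u, fst u))) has_derivative
      (\<lambda>u. antideriv_x a (partial_y f) (x, y) * fst (snd u, fst u) + f (x, y) * snd (snd u, fst u))) (at (x, y))"
    by (rule has_derivative_compose)
  then have "((\<lambda>u. G (snd u) (fst u)) has_derivative
      (\<lambda>u. antideriv_x a (partial_y f) (x, y) * snd u + f (x, y) * fst u)) (at (x, y))"
    by simp
  moreover have "(\<lambda>u. G (snd u) (fst u)) = antideriv_x a f"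
    by (simp add: G_def antideriv_x_def fun_eq_iff)
  ultimately show ?thesis by (simp add: algebra_simps)
qed

text \<open>The derivative involves only \<open>f\<close> and the antiderivative of another smooth
  function, \<open>partial_y f\<close>, so induction on the order succeeds for all smooth
  \<open>f\<close> at once.\<close>

lemma smooth_on_antideriv_x:
  assumes f: "smooth_on U f" and sub: "{a..b} \<times> {c..d} \<subseteq> U"
  shows "smooth_on ({a<..<b} \<times> {c<..<d}) (antideriv_x a f)"
proof -
  let ?B = "{a<..<b} \<times> {c<..<d}"
  have op: "open ?B" by (intro open_Times) auto
  have BU: "?B \<subseteq> U" using sub by (force simp: subset_iff)
  have D: "(antideriv_x a f has_derivative
      (\<lambda>v. fst v * f u + snd v * antideriv_x a (partial_y f) u)) (at u)"
    if "smooth_on U f" "u \<in> ?B" for f u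
    using antideriv_x_has_derivative[OF that(1) sub, of "fst u" "snd u"] that(2)
    by (simp add: mem_Times_iff)
  have cont: "continuous_on ?B (antideriv_x a f)" if "smooth_on U f" for f
    using D[OF that] has_derivative_continuous continuous_at_imp_continuous_on by blast
  have "higher_differentiable_on n ?B (antideriv_x a f)" if "smooth_on U f" for f n
    using that
  proof (induction n arbitrary: f)
    case 0
    then show ?case using cont by simp
  next
    case (Suc n)
    show ?case
    proof (rule higher_differentiable_on_SucI[OF op D[OF Suc.prems]])
      fix v
      have "higher_differentiable_on n ?B f"
        using smooth_on_subset[OF Suc.prems BU] by (simp add: smooth_on_def)
      then show "higher_differentiable_on n ?B (\<lambda>u. fst v * f u + snd v * antideriv_x a (partial_y f) u)"
        using Suc.IH[OF smooth_on_partial(2)[OF Suc.prems]]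
        by (intro higher_differentiable_on_add op higher_differentiable_on_const
            higher_differentiable_on_bilinear[OF bounded_bilinear_mult])
    qed
  qed
  then show ?thesis using f by (simp add: smooth_on_def)
qed

lemma antideriv_x_partial_x:
  assumes f: "smooth_on U f" and "{a..fst u} \<times> {snd u} \<subseteq> U" "a \<le> fst u"
  shows "antideriv_x a (partial_x f) u = f u - f (a, snd u)"
proof -
  have "((\<lambda>t. partial_x f (t, snd u)) has_integral (f (fst u, snd u) - f (a, snd u))) {a..fst u}"
    using assms
    by (intro fundamental_theorem_of_calculus)
      (auto simp: has_real_derivative_iff_has_vector_derivative[symmetric] subset_iff
        intro!: has_field_derivative_at_within partial_x_slice smooth_on_differentiable[OF f])
  then show ?thesis by (simp add: antideriv_x_def integral_unique)
qed

lemma open_contains_rectangle: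
  fixes u :: "real \<times> real"
  assumes "open U" "u \<in> U"
  obtains a b c d where "{a..b} \<times> {c..d} \<subseteq> U" "u \<in> {a<..<b} \<times> {c<..<d}"
proof -
  obtain p q where "cbox p q \<subseteq> U" "u \<in> box p q"
    using open_contains_cbox[OF assms] by metis
  then have "{fst p..fst q} \<times> {snd p..snd q} \<subseteq> U" "u \<in> {fst p<..<fst q} \<times> {snd p<..<snd q}"
    by (auto simp: cbox_Pair_eq[of "fst p" "snd p" "fst q" "snd q", simplified]
        mem_box Basis_prod_def mem_Times_iff inner_prod_def)
  then show ?thesis using that by blast
qed

text \<open>Write f(x,y) = f(a,y) + the integral of \<open>f_x\<close> from a to x. Differentiating
  in y under the integral sign gives \<open>f_y\<close> as a function of y alone plus the integral
  of the y-derivative of \<open>f_x\<close>; the x-derivative of this is the integrand.\<close>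

theorem partial_commute:
  fixes f :: "real \<times> real \<Rightarrow> real"
  assumes U: "open U" and f: "smooth_on U f" and u: "u \<in> U"
  shows "partial_x (partial_y f) u = partial_y (partial_x f) u"
proof -
  obtain a b c d where sub: "{a..b} \<times> {c..d} \<subseteq> U" and uB: "u \<in> {a<..<b} \<times> {c<..<d}"
    using open_contains_rectangle[OF U u] .
  let ?B = "{a<..<b} \<times> {c<..<d}"
  have op: "open ?B" by (intro open_Times) auto
  have BU: "?B \<subseteq> U" using sub by (force simp: subset_iff)
  have fx: "smooth_on U (partial_x f)" and fxy: "smooth_on U (partial_y (partial_x f))"
    using f by (auto intro: smooth_on_partial)
  have slice: "((\<lambda>w. f (a, snd w)) has_derivative (\<lambda>v. snd v * partial_y f (a, snd w))) (at w)"
    if "w \<in> ?B" for w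
  proof -
    have "((\<lambda>t. f (a, t)) has_derivative (\<lambda>h. h * partial_y f (a, snd w))) (at (snd w))"
      using partial_y_slice[OF smooth_on_differentiable[OF f], of a "snd w"] that sub
      by (auto simp: has_field_derivative_def mult_commute_abs subset_iff)
    then show ?thesis
      by (intro has_derivative_compose[of snd snd w UNIV "\<lambda>t. f (a, t)"])
        (auto intro!: derivative_eq_intros)
  qed
  have eq: "antideriv_x a (partial_x f) w = f w - f (a, snd w)" if "w \<in> ?B" for w
    using that sub by (intro antideriv_x_partial_x[OF f]) (auto simp: subset_iff)
  have smB: "smooth_on ?B (antideriv_x a (partial_y (partial_x f)))"
    by (rule smooth_on_antideriv_x[OF fxy sub])
  have y: "partial_y f w = antideriv_x a (partial_y (partial_x f)) w + partial_y f (a, snd w)"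
    if w: "w \<in> ?B" for w
  proof -
    have "((\<lambda>w. antideriv_x a (partial_x f) w + f (a, snd w)) has_derivative
      (\<lambda>v. (fst v * partial_x f w + snd v * antideriv_x a (partial_y (partial_x f)) w)
        + snd v * partial_y f (a, snd w))) (at w)"
      using antideriv_x_has_derivative[OF fx sub, of "fst w" "snd w"] w
      by (intro has_derivative_add slice) (auto simp: mem_Times_iff)
    from has_derivative_transform_within_open[OF this op w, of f] eq
    have "(f has_derivative
      (\<lambda>v. (fst v * partial_x f w + snd v * antideriv_x a (partial_y (partial_x f)) w)
        + snd v * partial_y f (a, snd w))) (at w)" by simp
    from partial_eqI(2)[OF this] show ?thesis by simp
  qed
  have "a < b" using uB by auto
  have "(a, snd u) \<in> U" using sub uB by (auto simp: subset_iff)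
  then have dg: "((\<lambda>t. partial_y f (a, t)) has_real_derivative partial_y (partial_y f) (a, snd u)) (at (snd u))"
    by (intro partial_y_slice smooth_on_differentiable[OF smooth_on_partial(2)[OF f]])
  then have dg': "(\<lambda>t. partial_y f (a, t)) differentiable (at (snd u))"
    by (auto simp: differentiable_def has_field_derivative_def)
  have "(\<lambda>w. partial_y f (a, snd w)) differentiable (at u)"
    using dg' by (intro differentiable_compose[of "\<lambda>t. partial_y f (a, t)" snd])
      (auto intro: bounded_linear_imp_differentiable bounded_linear_snd)
  moreover have "partial_x (\<lambda>w. partial_y f (a, snd w)) u = 0"
    using partial_snd_comp[OF dg'] .
  moreover have "partial_x (antideriv_x a (partial_y (partial_x f))) u = partial_y (partial_x f) u"
    using partial_eqI(1)[OF antideriv_x_has_derivative[OF fxy sub, of "fst u" "snd u"]] uB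
    by (simp add: mem_Times_iff)
  ultimately have "partial_x (\<lambda>w. antideriv_x a (partial_y (partial_x f)) w + partial_y f (a, snd w)) u
      = partial_y (partial_x f) u"
    using partial_algebra(1)[OF smooth_on_differentiable[OF smB uB], of "\<lambda>w. partial_y f (a, snd w)"]
    by simp
  then show ?thesis
    using partial_cong(1)[OF op uB y smooth_on_subset[OF smooth_on_partial(2)[OF f] BU]] by simp
qed

lemma smooth_onI_partials:
  fixes f :: "real \<times> real \<Rightarrow> real"
  assumes S: "open S" and D: "\<And>u. u \<in> S \<Longrightarrow> (f has_derivative (\<lambda>v. fst v * A u + snd v * B u)) (at u)"
    and A: "smooth_on S A" and B: "smooth_on S B"
  shows "smooth_on S f"
proof -
  have "higher_differentiable_on (Suc n) S f" for n
  proof (rule higher_differentiable_on_SucI[OF S D])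
    show "higher_differentiable_on n S (\<lambda>u. fst v * A u + snd v * B u)" for v
      using A B S unfolding smooth_on_def
      by (intro higher_differentiable_on_add higher_differentiable_on_const
            higher_differentiable_on_bilinear[OF bounded_bilinear_mult]) auto
  qed
  then show ?thesis unfolding smooth_on_def by (metis higher_differentiable_on_SucD)
qed

lemma local_antiderivative_x:
  fixes f :: "real \<times> real \<Rightarrow> real"
  assumes U: "open U" and f: "smooth_on U f" and u: "u \<in> U"
  obtains V F where "open V" "u \<in> V" "V \<subseteq> U" "smooth_on V F" "\<And>v. v \<in> V \<Longrightarrow> partial_x F v = f v"
proof -
  obtain a b c d where sub: "{a..b} \<times> {c..d} \<subseteq> U" and uB: "u \<in> {a<..<b} \<times> {c<..<d}"
    using open_contains_rectangle[OF U u] .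
  show ?thesis
  proof (rule that)
    show "smooth_on ({a<..<b} \<times> {c<..<d}) (antideriv_x a f)"
      by (rule smooth_on_antideriv_x[OF f sub])
    show "partial_x (antideriv_x a f) v = f v" if "v \<in> {a<..<b} \<times> {c<..<d}" for v
      using partial_eqI(1)[OF antideriv_x_has_derivative[OF f sub, of "fst v" "snd v"]] that
      by (simp add: mem_Times_iff)
    show "{a<..<b} \<times> {c<..<d} \<subseteq> U" using sub by (force simp: subset_iff)
  qed (use uB in \<open>auto intro: open_Times\<close>)
qed

text \<open>The Poincare lemma for a closed one-form \<open>A dx + B dy\<close>, on a rectangle
  around \<open>u\<close>.\<close>

theorem local_primitive:
  fixes A B :: "real \<times> real \<Rightarrow> real"
  assumes U: "open U" and A: "smooth_on U A" and B: "smooth_on U B" and u: "u \<in> U"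
    and closed: "\<And>v. v \<in> U \<Longrightarrow> partial_y A v = partial_x B v"
  obtains V F where "open V" "u \<in> V" "V \<subseteq> U" "smooth_on V F"
    "\<And>v. v \<in> V \<Longrightarrow> partial_x F v = A v" "\<And>v. v \<in> V \<Longrightarrow> partial_y F v = B v"
proof -
  obtain a b c d where sub: "{a..b} \<times> {c..d} \<subseteq> U" and uB: "u \<in> {a<..<b} \<times> {c<..<d}"
    using open_contains_rectangle[OF U u] .
  let ?V = "{a<..<b} \<times> {c<..<d}"
  \<comment> \<open>The integral of the form from (a, c) vertically to (a, y) and then horizontally
    to (x, y). Closedness turns the y-derivative of the horizontal part into B(x,y) -
    B(a,y).\<close>
  define F where "F w = antideriv_x a A w + integral {c..snd w} (\<lambda>t. B (a, t))" for w
  have op: "open ?V" by (intro open_Times) auto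
  have VU: "?V \<subseteq> U" using sub by (force simp: subset_iff)
  have D: "(F has_derivative (\<lambda>v. fst v * A w + snd v * B w)) (at w)" if w: "w \<in> ?V" for w
  proof -
    have "antideriv_x a (partial_y A) w = antideriv_x a (partial_x B) w"
      unfolding antideriv_x_def using w sub
      by (intro Henstock_Kurzweil_Integration.integral_cong closed) (auto simp: subset_iff)
    also have "\<dots> = B w - B (a, snd w)"
      using w sub by (intro antideriv_x_partial_x[OF B]) (auto simp: subset_iff)
    finally have eq: "antideriv_x a (partial_y A) w = B w - B (a, snd w)" .
    have "continuous_on {c..d} (\<lambda>t. B (a, t))"
      using sub w by (intro continuous_on_compose2[OF smooth_on_continuous_on[OF B]] continuous_intros) auto
    then have "((\<lambda>s. integral {c..s} (\<lambda>t. B (a, t))) has_real_derivative B (a, snd w)) (at (snd w) within {c..d})"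
      using w by (intro integral_has_real_derivative) auto
    then have "((\<lambda>s. integral {c..s} (\<lambda>t. B (a, t))) has_real_derivative B (a, snd w)) (at (snd w))"
      using w at_within_Icc_at[of c "snd w" d] by (auto simp: mem_Times_iff)
    then have "((\<lambda>s. integral {c..s} (\<lambda>t. B (a, t))) has_derivative (\<lambda>h. h * B (a, snd w))) (at (snd w))"
      by (simp add: has_field_derivative_def mult_commute_abs)
    then have "((\<lambda>w. integral {c..snd w} (\<lambda>t. B (a, t))) has_derivative (\<lambda>v. snd v * B (a, snd w))) (at w)"
      by (intro has_derivative_compose[of snd snd w UNIV "\<lambda>s. integral {c..s} (\<lambda>t. B (a, t))"])
        (auto intro!: derivative_eq_intros)
    from has_derivative_add[OF antideriv_x_has_derivative[OF A sub, of "fst w" "snd w"], unfolded prod.collapse, OF _ _ this]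
    show ?thesis using w by (simp add: F_def[abs_def] eq mem_Times_iff algebra_simps)
  qed
  show ?thesis
  proof (rule that[OF op uB VU])
    show "smooth_on ?V F"
      by (rule smooth_onI_partials[OF op D smooth_on_subset[OF A VU] smooth_on_subset[OF B VU]])
    show "partial_x F v = A v" "partial_y F v = B v" if "v \<in> ?V" for v
      using partial_eqI[OF D[OF that]] by simp_all
  qed
qed


section \<open>Embedded surfaces\<close>

text \<open>A left inverse of the derivative at \<open>u\<close>, together with continuity of the
  derivative in operator norm, gives injectivity near \<open>u\<close>. On a compact ball a
  continuous injection is a homeomorphism onto its image, and this restricts to the open ball of the
  same radius.\<close>

lemma immersion_locally_embedding:
  fixes X :: "real \<times> real \<Rightarrow> heis"
  assumes U: "open U" and X: "smooth_on U X" and u: "u \<in> U"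
    and inj: "\<And>v. v \<in> U \<Longrightarrow> inj (frechet_derivative X (at v))"
  obtains r where "r > 0" "ball u r \<subseteq> U" "smooth_embedding (ball u r) X"
proof -
  define X' where "X' = (\<lambda>v. frechet_derivative X (at v))"
  have D: "(X has_derivative X' v) (at v)" if "v \<in> U" for v
    using smooth_on_has_derivative[OF X that] by (simp add: X'_def)
  have X'_eq: "X' v w = fst w *\<^sub>R partial_x X v + snd w *\<^sub>R partial_y X v" if "v \<in> U" for v w
    using has_derivative_unique[OF D[OF that] smooth_on_has_derivative_partials[OF X that]] by simp
  obtain g where g: "linear g" "g \<circ> X' u = id"
    using linear_injective_left_inverse[OF has_derivative_linear[OF D[OF u]]] inj[OF u]
    by (auto simp: X'_def)
  \<comment> \<open>Smoothness yields continuity of the derivative in each fixed direction. The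
    operator norm is controlled by \<open>N\<close>, the sum of the changes of the two partial
    derivatives.\<close>
  have close: "\<exists>d>0. \<forall>v. dist u v < d \<longrightarrow> onorm (\<lambda>w. X' v w - X' u w) < e" if "e > 0" for e
  proof -
    define N where "N v = norm (partial_x X v - partial_x X u) + norm (partial_y X v - partial_y X u)" for v
    have "continuous_on U N"
      unfolding N_def using smooth_on_partial[OF X]
      by (intro continuous_intros smooth_on_continuous_on)
    then have "isCont N u" using U u continuous_on_eq_continuous_at by blast
    then obtain d where d: "d > 0" "\<And>v. dist v u < d \<Longrightarrow> dist (N v) (N u) < e"
      using \<open>e > 0\<close> unfolding continuous_at_eps_delta by (metis dist_commute)
    obtain d' where d': "d' > 0" "ball u d' \<subseteq> U" using U u open_contains_ball by blast
    have "onorm (\<lambda>w. X' v w - X' u w) < e" if v: "dist u v < min d d'" for v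
    proof -
      have vU: "v \<in> U" using v d' by auto
      have "norm (X' v w - X' u w) \<le> N v * norm w" for w
      proof -
        have "X' v w - X' u w = fst w *\<^sub>R (partial_x X v - partial_x X u) + snd w *\<^sub>R (partial_y X v - partial_y X u)"
          using vU u by (simp add: X'_eq algebra_simps)
        also have "norm \<dots> \<le> \<bar>fst w\<bar> * norm (partial_x X v - partial_x X u)
            + \<bar>snd w\<bar> * norm (partial_y X v - partial_y X u)"
          by (rule norm_triangle_le) simp
        also have "\<dots> \<le> norm w * norm (partial_x X v - partial_x X u)
            + norm w * norm (partial_y X v - partial_y X u)"
          using norm_fst_le[of "fst w" "snd w"] norm_snd_le[of "snd w" "fst w"]
          by (intro add_mono mult_right_mono) auto
        finally show ?thesis by (simp add: N_def algebra_simps)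
      qed
      then have "onorm (\<lambda>w. X' v w - X' u w) \<le> N v"
        by (intro onorm_bound) (auto simp: N_def)
      also have "\<dots> < e"
        using d(2)[of v] v by (simp add: dist_commute N_def dist_real_def)
      finally show ?thesis .
    qed
    then show ?thesis using d d' by (intro exI[of _ "min d d'"]) auto
  qed
  obtain r where r: "r > 0" "ball u r \<subseteq> U" "inj_on X (ball u r)"
    by (rule has_derivative_locally_injective[OF u U _ g(2) D close])
      (use g(1) linear_conv_bounded_linear in auto)
  have sub: "cball u (r / 2) \<subseteq> ball u r" "ball u (r / 2) \<subseteq> cball u (r / 2)" using r(1) by auto
  have "continuous_on (cball u (r / 2)) X"
    using smooth_on_continuous_on[OF X] sub r(2) continuous_on_subset by (metis subset_trans)
  then obtain Y where "homeomorphism (cball u (r / 2)) (X ` cball u (r / 2)) X Y"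
    using homeomorphism_compact[of "cball u (r / 2)" X] inj_on_subset[OF r(3) sub(1)] by auto
  then have "homeomorphism (ball u (r / 2)) (X ` ball u (r / 2)) X Y"
    using homeomorphism_of_subsets[OF _ sub(2)] sub(2) by blast
  then have "smooth_embedding (ball u (r / 2)) X"
    using sub r(2) inj smooth_on_subset[OF X] unfolding smooth_embedding_def by blast
  moreover have "ball u (r / 2) \<subseteq> U" using r(2) sub by blast
  ultimately show ?thesis using that[of "r / 2"] r(1) by simp
qed

text \<open>The witnessing curve is the image of the line through \<open>u\<close> in direction
  \<open>w\<close>, restricted to times at which the line stays in the open set
  \<open>V\<close>.\<close>

lemma frechet_derivative_in_tangent_space:
  assumes V: "open V" and X: "smooth_on V X" and u: "u \<in> V"
  shows "frechet_derivative X (at u) w \<in> tangent_space (X ` V) (X u)"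
proof -
  have lin: "bounded_linear (\<lambda>t::real. t *\<^sub>R w)" by (rule bounded_linear_scaleR_left)
  have "open ((\<lambda>t::real. u + t *\<^sub>R w) -` V)"
    using V by (intro open_vimage continuous_intros)
  moreover have "0 \<in> (\<lambda>t::real. u + t *\<^sub>R w) -` V" using u by simp
  ultimately obtain \<epsilon> where \<epsilon>: "\<epsilon> > 0" "ball 0 \<epsilon> \<subseteq> (\<lambda>t::real. u + t *\<^sub>R w) -` V"
    using open_contains_ball by blast
  then have in_V: "u + t *\<^sub>R w \<in> V" if "t \<in> {-\<epsilon><..<\<epsilon>}" for t
    using that by (auto simp: subset_iff dist_real_def)
  have "((\<lambda>t::real. u + t *\<^sub>R w) has_derivative (\<lambda>t. t *\<^sub>R w)) (at 0)"
    by (auto intro!: derivative_eq_intros)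
  moreover have DX: "(X has_derivative frechet_derivative X (at u)) (at (u + 0 *\<^sub>R w))"
    using smooth_on_has_derivative[OF X u] by simp
  ultimately have "((\<lambda>t. X (u + t *\<^sub>R w)) has_derivative (\<lambda>t. frechet_derivative X (at u) (t *\<^sub>R w))) (at 0)"
    by (rule has_derivative_compose)
  then have "((\<lambda>t. X (u + t *\<^sub>R w)) has_vector_derivative frechet_derivative X (at u) w) (at 0)"
    using linear_cmul[OF has_derivative_linear[OF DX]] by (simp add: has_vector_derivative_def)
  moreover have "smooth_on {-\<epsilon><..<\<epsilon>} (\<lambda>t. X (u + t *\<^sub>R w))"
    by (rule smooth_on_affine_comp[OF _ lin in_V X]) auto
  ultimately show ?thesis
    unfolding tangent_space_def using \<epsilon>(1) in_V
    by (intro CollectI exI[of _ "\<lambda>t. X (u + t *\<^sub>R w)"] exI[of _ \<epsilon>]) auto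
qed

lemma partials_span_tangent_space:
  assumes V: "open V" and X: "smooth_on V X" and u: "u \<in> V"
  shows "a *\<^sub>R partial_x X u + b *\<^sub>R partial_y X u \<in> tangent_space (X ` V) (X u)"
  using frechet_derivative_in_tangent_space[OF assms, of "(a, b)"]
    has_derivative_unique[OF smooth_on_has_derivative[OF X u] smooth_on_has_derivative_partials[OF X u]]
  by simp

section \<open>Computations in the left invariant frame\<close>

lemma contact_form_from_frame [simp]: "contact_form p (from_frame p w) = snd (snd w)"
  using arg_cong[OF frame_coords_from_frame[of p w], of "\<lambda>v. snd (snd v)"]
  by (simp add: frame_coords_def)

lemma heis_J_from_frame [simp]: "heis_J p (from_frame p (a, b, e)) = from_frame p (- b, a, 0)"
  by (simp add: heis_J_def frame_coords_from_frame) (simp add: from_frame_def)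

lemma adapted_metric_from_frame [simp]: "adapted_metric p (from_frame p v) (from_frame p w) = v \<bullet> w"
  by (simp add: adapted_metric_def frame_coords_from_frame)

lemma from_frame_linear:
  "from_frame p v + from_frame p w = from_frame p (v + w)"
  "r *\<^sub>R from_frame p w = from_frame p (r *\<^sub>R w)"
  "- from_frame p w = from_frame p (- w)"
  by (cases v; cases w; simp add: from_frame_def algebra_simps)+

lemma reeb_eq: "reeb = from_frame p (0, 0, 1)"
  by (simp add: from_frame_def)

lemma from_frame_eq_iff [simp]: "from_frame p v = from_frame p w \<longleftrightarrow> v = w"
  by (metis frame_coords_from_frame)

lemma e2_hat_from_frame:
  assumes "E p = from_frame p (c, s, 0)"
  shows "e2_hat E \<alpha> p = (1 / sqrt (1 + (\<alpha> p)\<^sup>2)) *\<^sub>R from_frame p (- \<alpha> p * s, \<alpha> p * c, 1)"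
  by (simp add: e2_hat_def assms reeb_eq[of p] from_frame_linear)

lemma smooth_embedding_inj_on: "smooth_embedding V X \<Longrightarrow> inj_on X V"
  unfolding smooth_embedding_def by (metis homeomorphism_apply1 inj_on_inverseI)

lemma on_surface_eq: "inj_on X V \<Longrightarrow> u \<in> V \<Longrightarrow> on_surface V X f (X u) = f u"
  by (simp add: on_surface_def the_inv_into_f_f)

text \<open>The derivative of \<open>f\<close> at \<open>u\<close> composed with a left inverse of that of \<open>X\<close> serves as a
  derivative of \<open>f \<circ> X\<^sup>-\<^sup>1\<close> within the surface.\<close>

lemma embedding_has_derivative_within:
  fixes f :: "real \<times> real \<Rightarrow> 'b::real_normed_vector"
  assumes emb: "smooth_embedding V X" and u: "u \<in> V" and f: "f differentiable (at u)"
  obtains D where "((\<lambda>p. f (the_inv_into V X p)) has_derivative D) (at (X u) within X ` V)"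
    "D (partial_x X u) = partial_x f u"
proof -
  have X: "smooth_on V X" and inj: "inj (frechet_derivative X (at u))"
    using emb u by (auto simp: smooth_embedding_def)
  obtain Y where Y: "homeomorphism V (X ` V) X Y" using emb by (auto simp: smooth_embedding_def)
  have inv: "the_inv_into V X p = Y p" if "p \<in> X ` V" for p
    using that Y smooth_embedding_inj_on[OF emb]
    by (metis homeomorphism_apply1 imageE the_inv_into_f_f)
  have DX: "(X has_derivative frechet_derivative X (at u)) (at u)"
    by (rule smooth_on_has_derivative[OF X u])
  obtain g where g: "linear g" "g \<circ> frechet_derivative X (at u) = id"
    using linear_injective_left_inverse[OF has_derivative_linear[OF DX] inj] by blast
  have "(Y has_derivative g) (at (X u) within X ` V)"
  proof (rule has_derivative_inverse_within[OF has_derivative_at_withinI[OF DX] _ u g])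
    show "continuous (at (X u) within X ` V) Y"
      using Y u by (auto simp: homeomorphism_def continuous_on_eq_continuous_within)
    show "Y (X v) = v" if "v \<in> V" for v using Y that by (rule homeomorphism_apply1)
  qed
  moreover have "(f has_derivative frechet_derivative f (at u)) (at (Y (X u)))"
    using f homeomorphism_apply1[OF Y u] frechet_derivative_works by metis
  ultimately have "((\<lambda>p. f (Y p)) has_derivative (\<lambda>v. frechet_derivative f (at u) (g v))) (at (X u) within X ` V)"
    by (rule has_derivative_compose)
  then have "((\<lambda>p. f (the_inv_into V X p)) has_derivative (\<lambda>v. frechet_derivative f (at u) (g v)))
      (at (X u) within X ` V)"
    by (rule has_derivative_transform[rotated 2]) (use inv u in auto)
  moreover have "g (partial_x X u) = (1, 0)"
    using g(2) by (simp add: partial_x_def o_def id_def fun_eq_iff)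
  ultimately show ?thesis using that by (simp add: partial_x_def)
qed

text \<open>Since \<open>J e_1\<close> has frame components (-s, c, 0), the equations for
  \<open>c_x\<close> and \<open>s_x\<close> say that its derivative along \<open>e_1\<close> is
  \<open>- H e_1\<close>. The last hypothesis makes a positive multiple of
  \<open>\<alpha> J e_1 + T\<close> tangent; as the contact form takes the value 1 on
  \<open>\<alpha> J e_1 + T\<close>, no point is singular.\<close>

lemma embedding_with_frameI:
  assumes emb: "smooth_embedding V X"
    and smooth: "smooth_on V c" "smooth_on V s"
    and unit: "\<And>u. u \<in> V \<Longrightarrow> (c u)\<^sup>2 + (s u)\<^sup>2 = 1"
    and c_x: "\<And>u. u \<in> V \<Longrightarrow> partial_x c u = - H u * s u"
    and s_x: "\<And>u. u \<in> V \<Longrightarrow> partial_x s u = H u * c u"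
    and X_x: "\<And>u. u \<in> V \<Longrightarrow> partial_x X u = from_frame (X u) (c u, s u, 0)"
    and X_ab: "\<And>u. u \<in> V \<Longrightarrow> a u *\<^sub>R partial_x X u + b u *\<^sub>R partial_y X u
        = (1 / sqrt (1 + (\<alpha> u)\<^sup>2)) *\<^sub>R from_frame (X u) (- \<alpha> u * s u, \<alpha> u * c u, 1)"
  shows "embedding_with_frame V X \<alpha> H a b"
proof -
  have V: "open V" and X: "smooth_on V X" using emb by (auto simp: smooth_embedding_def)
  have inj: "inj_on X V" by (rule smooth_embedding_inj_on[OF emb])
  define E where "E p = partial_x X (the_inv_into V X p)" for p
  have E: "E (X u) = partial_x X u" if "u \<in> V" for u
    using that inj by (simp add: E_def the_inv_into_f_f)
  have EX: "E (X u) = from_frame (X u) (c u, s u, 0)" if "u \<in> V" for u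
    using that by (simp add: E X_x)
  have e2: "e2_hat E (on_surface V X \<alpha>) (X u) = a u *\<^sub>R partial_x X u + b u *\<^sub>R partial_y X u"
    if "u \<in> V" for u
    using e2_hat_from_frame[of E "X u", OF EX[OF that]] that by (simp add: on_surface_eq[OF inj] X_ab)
  have par: "local_parametrization (X ` V) V X"
    using emb by (simp add: local_parametrization_def)
  have T: "on_surface V X \<alpha> (X u) *\<^sub>R heis_J (X u) (E (X u)) + reeb \<in> tangent_space (X ` V) (X u)"
    if u: "u \<in> V" for u
  proof -
    define d where "d = sqrt (1 + (\<alpha> u)\<^sup>2)"
    have "d > 0" unfolding d_def by (simp add: add_pos_nonneg)
    have "on_surface V X \<alpha> (X u) *\<^sub>R heis_J (X u) (E (X u)) + reeb = d *\<^sub>R e2_hat E (on_surface V X \<alpha>) (X u)"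
      using \<open>d > 0\<close> u by (simp add: e2_hat_def on_surface_eq[OF inj] d_def)
    also have "\<dots> = (d * a u) *\<^sub>R partial_x X u + (d * b u) *\<^sub>R partial_y X u"
      using u by (simp add: e2 algebra_simps)
    also have "\<dots> \<in> tangent_space (X ` V) (X u)"
      by (rule partials_span_tangent_space[OF V X u])
    finally show ?thesis .
  qed
  have "regular_surface (X ` V)"
    unfolding regular_surface_def singular_point_def
  proof (intro conjI notI)
    show "smooth_surface (X ` V)" using par by (auto simp: smooth_surface_def)
    assume "\<exists>p. p \<in> X ` V \<and> tangent_space (X ` V) p = contact_plane p"
    then obtain u where u: "u \<in> V" "tangent_space (X ` V) (X u) = contact_plane (X u)" by auto
    have "contact_form (X u) (on_surface V X \<alpha> (X u) *\<^sub>R heis_J (X u) (E (X u)) + reeb) = 1"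
      by (simp add: EX u(1) reeb_eq[of "X u"] from_frame_linear)
    then show False using T[OF u(1)] u(2) by (simp add: contact_plane_def)
  qed
  moreover have "characteristic_field (X ` V) E"
    unfolding characteristic_field_def smooth_on_surface_def
  proof (intro conjI ballI)
    fix p assume "p \<in> X ` V"
    then obtain u where u: "u \<in> V" "p = X u" by blast
    have "smooth_on V (\<lambda>u. E (X u))"
      by (rule smooth_on_cong[OF V _ smooth_on_partial(1)[OF X]]) (simp add: E)
    then show "\<exists>U Y. local_parametrization (X ` V) U Y \<and> p \<in> Y ` U \<and> smooth_on U (\<lambda>u. E (Y u))"
      using par u by blast
    show "adapted_metric p (E p) (E p) = 1"
      using unit[OF u(1)] u by (simp add: EX power2_eq_square)
    show "E p \<in> tangent_space (X ` V) p \<inter> contact_plane p"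
      using partials_span_tangent_space[OF V X u(1), of 1 0] u
      by (simp add: E) (simp add: contact_plane_def X_x)
  qed
  moreover have "p_mean_curvature (X ` V) E (on_surface V X H)"
    unfolding p_mean_curvature_def has_covariant_derivative_def
  proof
    fix p assume "p \<in> X ` V"
    then obtain u where u: "u \<in> V" "p = X u" by blast
    define f where "f v = (- s v, c v, 0::real)" for v
    have sm: "smooth_on V f" unfolding f_def by (intro smooth_on_intros V smooth)
    obtain D where D: "((\<lambda>p. f (the_inv_into V X p)) has_derivative D) (at (X u) within X ` V)"
      "D (partial_x X u) = partial_x f u"
      using embedding_has_derivative_within[OF emb u(1) smooth_on_differentiable[OF sm u(1)]] .
    have "((\<lambda>q. frame_coords q (heis_J q (E q))) has_derivative D) (at (X u) within X ` V)"
      by (rule has_derivative_transform[OF _ _ D(1)])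
        (use u inj in \<open>auto simp: f_def EX frame_coords_from_frame the_inv_into_f_f\<close>)
    moreover have "partial_x f u = (- partial_x s u, partial_x c u, 0)"
      using partial_eqI(1)[OF has_derivative_Pair[OF
            has_derivative_minus[OF smooth_on_has_derivative_partials[OF smooth(2) u(1)]]
            has_derivative_Pair[OF smooth_on_has_derivative_partials[OF smooth(1) u(1)]
              has_derivative_const[of 0]]]]
      by (simp add: f_def[abs_def])
    ultimately show "\<exists>D. ((\<lambda>q. frame_coords q (heis_J q (E q))) has_derivative D) (at p within X ` V) \<and>
          - (on_surface V X H p *\<^sub>R E p) = from_frame p (D (E p))"
      using u D(2) c_x[OF u(1)] s_x[OF u(1)]
      by (intro exI[of _ D])
        (simp add: E[symmetric] on_surface_eq[OF inj],
         simp add: EX from_frame_linear)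
  qed
  moreover have "alpha_function (X ` V) E (on_surface V X \<alpha>)"
    unfolding alpha_function_def using T by auto
  ultimately show ?thesis
    unfolding embedding_with_frame_def embedding_with_invariants_def using emb E e2 by auto
qed


section \<open>The structure equations\<close>

text \<open>The functions \<open>c\<close> and \<open>s\<close> below are the cosine and sine of the angle of the characteristic
  direction \<open>e\<^sub>1 = X\<^sub>x\<close> in the left invariant frame, and \<open>X\<^sub>y = r e\<^sub>1 + p J e\<^sub>1 + q T\<close>.\<close>

locale characteristic_patch =
  fixes U :: "(real \<times> real) set" and X :: "real \<times> real \<Rightarrow> heis" and \<kappa> :: "real \<times> real \<Rightarrow> real"
  assumes open_U: "open U" and smooth_X: "smooth_on U X"
    and contact: "u \<in> U \<Longrightarrow> contact_form (X u) (partial_x X u) = 0"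
    and unit: "u \<in> U \<Longrightarrow> (fst (partial_x X u))\<^sup>2 + (fst (snd (partial_x X u)))\<^sup>2 = 1"
    and turn: "u \<in> U \<Longrightarrow> partial_x (\<lambda>u. fst (partial_x X u)) u = - \<kappa> u * fst (snd (partial_x X u))"
      "u \<in> U \<Longrightarrow> partial_x (\<lambda>u. fst (snd (partial_x X u))) u = \<kappa> u * fst (partial_x X u)"
begin

definition "x1 u = fst (X u)"
definition "x2 u = fst (snd (X u))"
definition "x3 u = snd (snd (X u))"
definition "c u = fst (partial_x X u)"
definition "s u = fst (snd (partial_x X u))"
definition "r u = c u * partial_y x1 u + s u * partial_y x2 u"
definition "p u = c u * partial_y x2 u - s u * partial_y x1 u"
definition "q u = partial_y x3 u + x1 u * partial_y x2 u - x2 u * partial_y x1 u"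
text \<open>The y-derivative of the angle. Expressing it by \<open>p\<close>, \<open>r\<close> and
  \<kappa> shows that it agrees for two surfaces as soon as these do.\<close>

definition "\<omega> u = partial_x p u + \<kappa> u * r u"

lemma X_eq: "X u = (x1 u, x2 u, x3 u)"
  by (simp add: x1_def x2_def x3_def)

lemma smooth_coords: "smooth_on U x1" "smooth_on U x2" "smooth_on U x3"
  unfolding x1_def[abs_def] x2_def[abs_def] x3_def[abs_def] using open_U smooth_X
  by (auto intro!: smooth_on_linear_comp[of fst U X] smooth_on_linear_comp[of "\<lambda>v. fst (snd v)" U X]
      smooth_on_linear_comp[of "\<lambda>v. snd (snd v)" U X]
      bounded_linear_fst bounded_linear_fst_comp bounded_linear_snd_comp bounded_linear_snd)

lemma partial_X:
  assumes "u \<in> U"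
  shows "partial_x X u = (c u, s u, partial_x x3 u)" "partial_x x1 u = c u" "partial_x x2 u = s u"
    "partial_y X u = (partial_y x1 u, partial_y x2 u, partial_y x3 u)"
proof -
  note D = smooth_on_differentiable[OF smooth_X assms]
  note L = partial_bounded_linear[OF bounded_linear_fst D]
    partial_bounded_linear[OF bounded_linear_fst_comp[OF bounded_linear_snd] D]
    partial_bounded_linear[OF bounded_linear_snd_comp[OF bounded_linear_snd] D]
  show "partial_x X u = (c u, s u, partial_x x3 u)" "partial_x x1 u = c u" "partial_x x2 u = s u"
    "partial_y X u = (partial_y x1 u, partial_y x2 u, partial_y x3 u)"
    using L by (simp_all add: x1_def[abs_def] x2_def[abs_def] x3_def[abs_def] c_def s_def)
qed

lemma unit': "u \<in> U \<Longrightarrow> c u * c u + s u * s u = 1"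
  using unit by (simp add: c_def s_def power2_eq_square)

lemma turn': "u \<in> U \<Longrightarrow> partial_x c u = - \<kappa> u * s u" "u \<in> U \<Longrightarrow> partial_x s u = \<kappa> u * c u"
  using turn by (simp_all add: c_def[abs_def] s_def[abs_def])

lemma partial_x3: "u \<in> U \<Longrightarrow> partial_x x3 u = x2 u * c u - x1 u * s u"
  using contact[of u] by (simp add: partial_X X_eq contact_form_def)

lemma partial_y_coords:
  assumes u: "u \<in> U"
  shows "partial_y x1 u = r u * c u - p u * s u" "partial_y x2 u = r u * s u + p u * c u"
    "partial_y x3 u = q u - x1 u * (r u * s u + p u * c u) + x2 u * (r u * c u - p u * s u)"
proof -
  have "r u * c u - p u * s u = (c u * c u + s u * s u) * partial_y x1 u"
    "r u * s u + p u * c u = (c u * c u + s u * s u) * partial_y x2 u"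
    by (simp_all add: r_def p_def algebra_simps)
  then show "partial_y x1 u = r u * c u - p u * s u" "partial_y x2 u = r u * s u + p u * c u"
    "partial_y x3 u = q u - x1 u * (r u * s u + p u * c u) + x2 u * (r u * c u - p u * s u)"
    by (simp_all add: unit'[OF u] q_def)
qed

lemma partial_X_from_frame:
  assumes u: "u \<in> U"
  shows "partial_x X u = from_frame (X u) (c u, s u, 0)"
    "partial_y X u = from_frame (X u) (r u * c u - p u * s u, r u * s u + p u * c u, q u)"
  by (simp_all add: partial_X(1,4)[OF u] partial_x3[OF u] partial_y_coords[OF u] X_eq
      from_frame_def std_e1_def std_e2_def reeb_def)

lemma smooth_cs: "smooth_on U c" "smooth_on U s"
  using smooth_on_cong[OF open_U partial_X(2) smooth_on_partial(1)[OF smooth_coords(1)]]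
    smooth_on_cong[OF open_U partial_X(3) smooth_on_partial(1)[OF smooth_coords(2)]]
  by simp_all

lemma smooth_pqr: "smooth_on U p" "smooth_on U q" "smooth_on U r"
  unfolding p_def[abs_def] q_def[abs_def] r_def[abs_def]
  by (intro smooth_on_intros open_U smooth_coords smooth_cs)+

text \<open>These are the equalities of mixed partial derivatives of the three coordinates of
  \<open>X\<close>, with \<open>x1_x = c\<close>, \<open>x2_x = s\<close> and \<open>x3_x\<close>
  given by the contact condition, rewritten in the rotating frame.\<close>

lemma structure_equations:
  assumes u: "u \<in> U"
  shows "partial_x r u = \<kappa> u * p u" "partial_x q u = 2 * p u"
    "partial_y c u = - \<omega> u * s u" "partial_y s u = \<omega> u * c u"
proof -
  note diff = smooth_on_differentiable[OF _ u]
  note D = smooth_coords[THEN diff] smooth_coords[THEN smooth_on_partial(2), THEN diff] smooth_cs[THEN diff]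
  have commute: "partial_x (partial_y x1) u = partial_y c u" "partial_x (partial_y x2) u = partial_y s u"
    using partial_commute[OF open_U smooth_coords(1) u] partial_commute[OF open_U smooth_coords(2) u]
      partial_cong(2)[OF open_U u partial_X(2) smooth_on_partial(1)[OF smooth_coords(1)]]
      partial_cong(2)[OF open_U u partial_X(3) smooth_on_partial(1)[OF smooth_coords(2)]]
    by simp_all
  have "partial_x (partial_y x3) u = partial_y (partial_x x3) u"
    by (rule partial_commute[OF open_U smooth_coords(3) u])
  also have "\<dots> = partial_y (\<lambda>u. x2 u * c u - x1 u * s u) u"
    by (rule partial_cong(2)[OF open_U u partial_x3 smooth_on_partial(1)[OF smooth_coords(3)]])
  also have "\<dots> = partial_y x2 u * c u + x2 u * partial_y c u - (partial_y x1 u * s u + x1 u * partial_y s u)"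
    by (simp add: partial_algebra D differentiable_mult)
  finally have commute3: "partial_x (partial_y x3) u
    = partial_y x2 u * c u + x2 u * partial_y c u - (partial_y x1 u * s u + x1 u * partial_y s u)" .
  \<comment> \<open>Differentiating the unit length condition shows that (\<open>c_y\<close>,
    \<open>s_y\<close>) is a multiple of (-s, c); the multiple \<open>c s_y - s c_y\<close> is
    identified with \<omega> below.\<close>
  have "partial_y (\<lambda>u. c u * c u + s u * s u) u = partial_y (\<lambda>_. 1 :: real) u"
    by (rule partial_cong(2)[OF open_U u unit']) (auto intro!: smooth_on_intros open_U smooth_cs)
  then have ortho: "c u * partial_y c u + s u * partial_y s u = 0"
    by (simp add: partial_algebra D differentiable_mult)
  have r_x: "partial_x r u = partial_x c u * partial_y x1 u + c u * partial_y c u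
      + (partial_x s u * partial_y x2 u + s u * partial_y s u)"
    unfolding r_def[abs_def] by (simp add: partial_algebra D differentiable_mult commute)
  then show "partial_x r u = \<kappa> u * p u"
    using ortho by (simp add: turn'[OF u] p_def algebra_simps)
  have q_x: "partial_x q u = partial_x (partial_y x3) u + (partial_x x1 u * partial_y x2 u + x1 u * partial_y s u)
      - (partial_x x2 u * partial_y x1 u + x2 u * partial_y c u)"
    unfolding q_def[abs_def]
    by (simp add: partial_algebra D differentiable_mult differentiable_add commute)
  then show "partial_x q u = 2 * p u"
    by (simp add: commute3 partial_X(2,3)[OF u] p_def algebra_simps)
  have p_x: "partial_x p u = partial_x c u * partial_y x2 u + c u * partial_y s u
      - (partial_x s u * partial_y x1 u + s u * partial_y c u)"
    unfolding p_def[abs_def] by (simp add: partial_algebra D differentiable_mult commute)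
  then have \<omega>: "\<omega> u = c u * partial_y s u - s u * partial_y c u"
    by (simp add: \<omega>_def turn'[OF u] r_def algebra_simps)
  have "partial_y c u = (c u * c u + s u * s u) * partial_y c u" by (simp add: unit'[OF u])
  also have "\<dots> = - \<omega> u * s u + c u * (c u * partial_y c u + s u * partial_y s u)"
    unfolding \<omega> by algebra
  finally show "partial_y c u = - \<omega> u * s u" by (simp add: ortho)
  have "partial_y s u = (c u * c u + s u * s u) * partial_y s u" by (simp add: unit'[OF u])
  also have "\<dots> = \<omega> u * c u + s u * (c u * partial_y c u + s u * partial_y s u)"
    unfolding \<omega> by algebra
  finally show "partial_y s u = \<omega> u * c u" by (simp add: ortho)
qed

text \<open>The three relations are the projections of the two expressions for \<open>e2_hat\<close>
  onto \<open>e_1\<close>, \<open>J e_1\<close> and \<open>T\<close>, that is, onto (c, s, 0), (-s,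
  c, 0) and (0, 0, 1) in frame components.\<close>

lemma e2_hat_coefficients:
  assumes u: "u \<in> U" and E: "E (X u) = partial_x X u"
    and ab: "e2_hat E \<beta> (X u) = a *\<^sub>R partial_x X u + b *\<^sub>R partial_y X u"
  shows "a + b * r u = 0" "b * p u = \<beta> (X u) / sqrt (1 + (\<beta> (X u))\<^sup>2)"
    "b * q u = 1 / sqrt (1 + (\<beta> (X u))\<^sup>2)"
proof -
  define d where "d = 1 / sqrt (1 + (\<beta> (X u))\<^sup>2)"
  have "e2_hat E \<beta> (X u) = d *\<^sub>R from_frame (X u) (- \<beta> (X u) * s u, \<beta> (X u) * c u, 1)"
    unfolding d_def by (rule e2_hat_from_frame) (simp add: E partial_X_from_frame[OF u])
  with ab have eq: "d *\<^sub>R (- \<beta> (X u) * s u, \<beta> (X u) * c u, 1) =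
      a *\<^sub>R (c u, s u, 0) + b *\<^sub>R (r u * c u - p u * s u, r u * s u + p u * c u, q u)"
    by (simp only: partial_X_from_frame[OF u] from_frame_linear from_frame_eq_iff)
  have eq1: "- (d * (\<beta> (X u) * s u)) = a * c u + b * (r u * c u - p u * s u)"
    using arg_cong[OF eq, of fst] by simp
  have eq2: "d * (\<beta> (X u) * c u) = a * s u + b * (r u * s u + p u * c u)"
    using arg_cong[OF eq, of "\<lambda>v. fst (snd v)"] by simp
  have eq3: "d = b * q u"
    using arg_cong[OF eq, of "\<lambda>v. snd (snd v)"] by simp
  have "a + b * r u = (a + b * r u) * (c u * c u + s u * s u)" by (simp add: unit'[OF u])
  also have "\<dots> = c u * (a * c u + b * (r u * c u - p u * s u)) + s u * (a * s u + b * (r u * s u + p u * c u))"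
    by algebra
  also have "\<dots> = 0" unfolding eq1[symmetric] eq2[symmetric] by algebra
  finally show "a + b * r u = 0" .
  have "b * p u = b * p u * (c u * c u + s u * s u)" by (simp add: unit'[OF u])
  also have "\<dots> = c u * (a * s u + b * (r u * s u + p u * c u)) - s u * (a * c u + b * (r u * c u - p u * s u))"
    by algebra
  also have "\<dots> = d * \<beta> (X u) * (c u * c u + s u * s u)" unfolding eq1[symmetric] eq2[symmetric] by algebra
  finally show "b * p u = \<beta> (X u) / sqrt (1 + (\<beta> (X u))\<^sup>2)" by (simp add: unit'[OF u] d_def)
  show "b * q u = 1 / sqrt (1 + (\<beta> (X u))\<^sup>2)" using eq3 by (simp add: d_def)
qed

end

text \<open>The derivative \<open>D\<close> within \<open>S\<close> supplied by
  \<open>p_mean_curvature\<close> is not unique, but composed with \<open>X\<close> it becomes an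
  ordinary derivative of (-s, c, 0) on an open set of parameters. That one is unique, which forces
  the value of \<open>D\<close> on \<open>X_x\<close>.\<close>

lemma surface_characteristic_patch:
  assumes U: "open U" and X: "smooth_on U X" and sub: "X ` U \<subseteq> S"
    and E: "characteristic_field S E" and H: "p_mean_curvature S E H"
    and X_x: "\<And>u. u \<in> U \<Longrightarrow> partial_x X u = E (X u)"
  shows "characteristic_patch U X (\<lambda>u. H (X u))"
proof -
  define c where "c u = fst (partial_x X u)" for u
  define s where "s u = fst (snd (partial_x X u))" for u
  have coords: "frame_coords (X u) (E (X u)) = (c u, s u, 0)" if "u \<in> U" for u
    using that E sub X_x[OF that]
    by (auto simp: frame_coords_def c_def s_def characteristic_field_def contact_plane_def image_subset_iff)
  then have EX: "E (X u) = from_frame (X u) (c u, s u, 0)" if "u \<in> U" for u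
    using that from_frame_frame_coords by metis
  have smooth: "smooth_on U c" "smooth_on U s"
    unfolding c_def[abs_def] s_def[abs_def] using U smooth_on_partial(1)[OF X]
    by (auto intro!: smooth_on_linear_comp[of fst U] smooth_on_linear_comp[of "\<lambda>v. fst (snd v)" U]
      bounded_linear_fst bounded_linear_fst_comp bounded_linear_snd)
  have turn: "partial_x c u = - H (X u) * s u \<and> partial_x s u = H (X u) * c u" if u: "u \<in> U" for u
  proof -
    have "X u \<in> S" using u sub by blast
    then obtain D where D: "((\<lambda>q. frame_coords q (heis_J q (E q))) has_derivative D) (at (X u) within S)"
      and w: "- (H (X u) *\<^sub>R E (X u)) = from_frame (X u) (D (E (X u)))"
      using H unfolding p_mean_curvature_def has_covariant_derivative_def by blast
    have "((\<lambda>v. frame_coords (X v) (heis_J (X v) (E (X v)))) has_derivative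
        (\<lambda>w. D (frechet_derivative X (at u) w))) (at u within U)"
      by (rule has_derivative_in_compose[OF has_derivative_at_withinI[OF smooth_on_has_derivative[OF X u]]
            has_derivative_subset[OF D sub]])
    then have "((\<lambda>v. frame_coords (X v) (heis_J (X v) (E (X v)))) has_derivative
        (\<lambda>w. D (frechet_derivative X (at u) w))) (at u)"
      by (simp only: at_within_open[OF u U])
    then have "((\<lambda>v. (- s v, c v, 0 :: real)) has_derivative (\<lambda>w. D (frechet_derivative X (at u) w))) (at u)"
      by (rule has_derivative_transform_within_open[OF _ U u]) (simp add: EX frame_coords_from_frame)
    note D' = this
    have "((\<lambda>v. (- s v, c v, 0 :: real)) has_derivative
       (\<lambda>w. (- (fst w *\<^sub>R partial_x s u + snd w *\<^sub>R partial_y s u),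
          fst w *\<^sub>R partial_x c u + snd w *\<^sub>R partial_y c u, 0))) (at u)"
      by (intro has_derivative_Pair has_derivative_minus has_derivative_const
          smooth_on_has_derivative_partials[OF smooth(1) u] smooth_on_has_derivative_partials[OF smooth(2) u])
    from fun_cong[OF has_derivative_unique[OF D' this], of "(1, 0)"]
    have "D (partial_x X u) = (- partial_x s u, partial_x c u, 0)"
      by (simp add: partial_x_def[of X])
    with w X_x[OF u] show ?thesis by (simp add: EX[OF u] from_frame_linear)
  qed
  show ?thesis
  proof
    fix u assume u: "u \<in> U"
    show "contact_form (X u) (partial_x X u) = 0"
      using coords[OF u] X_x[OF u] by (simp add: frame_coords_def)
    have "adapted_metric (X u) (E (X u)) (E (X u)) = 1"
      using u E sub by (auto simp: characteristic_field_def)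
    then show "(fst (partial_x X u))\<^sup>2 + (fst (snd (partial_x X u)))\<^sup>2 = 1"
      using u by (simp add: EX power2_eq_square) (simp add: c_def s_def)
    show "partial_x (\<lambda>u. fst (partial_x X u)) u = - H (X u) * fst (snd (partial_x X u))"
      "partial_x (\<lambda>u. fst (snd (partial_x X u))) u = H (X u) * fst (partial_x X u)"
      using turn[OF u] by (simp_all add: c_def[abs_def] s_def[abs_def])
  qed fact+
qed


section \<open>The Codazzi-like equation\<close>

text \<open>The locale assumes no regularity of \<kappa>; for constant \<kappa> the defining formula
  of \<omega> is visibly smooth and can be differentiated once more. Smoothness of \<alpha> comes
  from the quotient \<open>p / q\<close>.\<close>

lemma (in characteristic_patch) codazzi_lienard_constant_curvature:
  assumes const: "\<And>u. u \<in> U \<Longrightarrow> \<kappa> u = k" and pos: "\<And>u. u \<in> U \<Longrightarrow> q u > 0"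
    and \<alpha>: "\<And>u. u \<in> U \<Longrightarrow> \<alpha> u * q u = p u"
  shows "smooth_on U \<alpha>" "codazzi_lienard k U \<alpha>"
proof -
  have "smooth_on U (\<lambda>u. p u * inverse (q u))"
    using pos by (intro smooth_on_intros open_U smooth_pqr smooth_on_real_comp[OF smooth_on_inverse_real]) auto
  then show sm: "smooth_on U \<alpha>"
    by (rule smooth_on_cong[OF open_U, rotated]) (use pos \<alpha> in \<open>force simp: field_simps\<close>)
  note sm_x = smooth_on_partial(1)[OF sm]
  have \<omega>: "\<omega> u = partial_x p u + k * r u" if "u \<in> U" for u
    using const[OF that] by (simp add: \<omega>_def)
  have sm_\<omega>: "smooth_on U \<omega>"
    by (rule smooth_on_cong[OF open_U \<omega>[symmetric]])
      (auto intro!: smooth_on_intros open_U smooth_pqr)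
  show "codazzi_lienard k U \<alpha>"
    unfolding codazzi_lienard_def
  proof
    fix u assume u: "u \<in> U"
    note diff = smooth_on_differentiable[OF _ u]
    note D = smooth_pqr[THEN diff] smooth_pqr(1)[THEN smooth_on_partial(1), THEN diff] smooth_cs[THEN diff]
      sm[THEN diff] sm_x[THEN diff] sm_\<omega>[THEN diff]
    \<comment> \<open>Commuting the mixed derivatives of \<open>c\<close> leaves
      \<open>\<omega>_x s = 0\<close>, and those of \<open>s\<close> leave
      \<open>\<omega>_x c = 0\<close>. As c and s do not vanish together,
      \<open>\<omega>_x = 0\<close>, which is the equation for \<open>p_xx\<close>.\<close>
    have s: "partial_x (\<lambda>u. - (\<omega> u * s u)) u = partial_y (\<lambda>u. - (k * s u)) u"
    proof -
      have "partial_x (\<lambda>u. - (\<omega> u * s u)) u = partial_x (partial_y c) u"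
        by (rule partial_cong(1)[OF open_U u])
          (auto simp: structure_equations intro!: smooth_on_intros open_U smooth_cs sm_\<omega>)
      also have "\<dots> = partial_y (partial_x c) u" by (rule partial_commute[OF open_U smooth_cs(1) u])
      also have "\<dots> = partial_y (\<lambda>u. - (k * s u)) u"
        by (rule partial_cong(2)[OF open_U u])
          (auto simp: turn' const intro!: smooth_on_intros smooth_cs)
      finally show ?thesis .
    qed
    have c: "partial_x (\<lambda>u. \<omega> u * c u) u = partial_y (\<lambda>u. k * c u) u"
    proof -
      have "partial_x (\<lambda>u. \<omega> u * c u) u = partial_x (partial_y s) u"
        by (rule partial_cong(1)[OF open_U u])
          (auto simp: structure_equations intro!: smooth_on_intros open_U smooth_cs sm_\<omega>)
      also have "\<dots> = partial_y (partial_x s) u" by (rule partial_commute[OF open_U smooth_cs(2) u])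
      also have "\<dots> = partial_y (\<lambda>u. k * c u) u"
        by (rule partial_cong(2)[OF open_U u])
          (auto simp: turn' const intro!: smooth_on_intros smooth_cs)
      finally show ?thesis .
    qed
    have "partial_x \<omega> u * s u = 0" "partial_x \<omega> u * c u = 0"
      using s c by (simp_all add: partial_algebra partial_minus D differentiable_mult turn'[OF u]
          const[OF u] structure_equations[OF u])
    then have "partial_x \<omega> u = 0" using unit'[OF u] by auto
    moreover have "partial_x \<omega> u = partial_x (\<lambda>u. partial_x p u + k * r u) u"
      by (rule partial_cong(1)[OF open_U u \<omega> sm_\<omega>])
    ultimately have p_xx: "partial_x (partial_x p) u = - (k\<^sup>2 * p u)"
      by (simp add: partial_algebra D differentiable_mult structure_equations(1)[OF u] const[OF u]
          power2_eq_square)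
    have p_x: "partial_x p v = partial_x \<alpha> v * q v + 2 * (\<alpha> v * p v)" if v: "v \<in> U" for v
    proof -
      have "partial_x p v = partial_x (\<lambda>u. \<alpha> u * q u) v"
        by (rule partial_cong(1)[OF open_U v \<alpha>[symmetric] smooth_pqr(1)])
      then show ?thesis
        using smooth_on_differentiable[OF sm v] smooth_on_differentiable[OF smooth_pqr(2) v]
        by (simp add: partial_algebra structure_equations(2)[OF v])
    qed
    have "partial_x (partial_x p) u = partial_x (\<lambda>v. partial_x \<alpha> v * q v + 2 * (\<alpha> v * p v)) u"
      by (rule partial_cong(1)[OF open_U u p_x smooth_on_partial(1)[OF smooth_pqr(1)]])
    also have "\<dots> = partial_x (partial_x \<alpha>) u * q u + partial_x \<alpha> u * (2 * p u)
        + 2 * (partial_x \<alpha> u * p u + \<alpha> u * partial_x p u)"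
      by (simp add: partial_algebra D differentiable_mult structure_equations(2)[OF u])
    finally have "q u * (partial_x (partial_x \<alpha>) u + 6 * \<alpha> u * partial_x \<alpha> u + 4 * (\<alpha> u)^3 + k\<^sup>2 * \<alpha> u) = 0"
      using p_xx p_x[OF u] \<alpha>[OF u, symmetric] by algebra
    then show "partial_x (partial_x \<alpha>) u + 6 * \<alpha> u * partial_x \<alpha> u + 4 * (\<alpha> u)^3 + k\<^sup>2 * \<alpha> u = 0"
      using pos[OF u] by simp
  qed
qed

text \<open>The convention \<open>b > 0\<close> enters through
  \<open>b q = 1 / sqrt (1 + \<alpha>\<^sup>2)\<close>: it makes \<open>q\<close> positive, and
  cancelling \<open>b\<close> gives \<open>\<alpha> q = p\<close>.\<close>

proposition codazzi_lienard_surface: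
  assumes E: "characteristic_field S E" and H: "p_mean_curvature S E H" "\<And>p. p \<in> S \<Longrightarrow> H p = k"
    and UX: "compatible_coordinates S E \<alpha> U X"
  shows "smooth_on U (\<lambda>u. \<alpha> (X u))" "codazzi_lienard k U (\<lambda>u. \<alpha> (X u))"
proof -
  have U: "open U" and X: "smooth_on U X" and sub: "X ` U \<subseteq> S"
    using UX by (auto simp: compatible_coordinates_def local_parametrization_def smooth_embedding_def
        dest!: openin_imp_subset)
  interpret characteristic_patch U X "\<lambda>u. H (X u)"
    using UX by (intro surface_characteristic_patch[OF U X sub E H(1)])
      (auto simp: compatible_coordinates_def)
  have *: "q u > 0 \<and> \<alpha> (X u) * q u = p u" if u: "u \<in> U" for u
  proof -
    obtain a b where b: "b > 0" and ab: "e2_hat E \<alpha> (X u) = a *\<^sub>R partial_x X u + b *\<^sub>R partial_y X u"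
      and X_x: "E (X u) = partial_x X u"
      using UX u unfolding compatible_coordinates_def by metis
    note eq = e2_hat_coefficients[OF u X_x ab]
    have "sqrt (1 + (\<alpha> (X u))\<^sup>2) > 0" by (simp add: add_pos_nonneg)
    then have "b * q u > 0" unfolding eq(3) by simp
    moreover have "b * (\<alpha> (X u) * q u) = \<alpha> (X u) * (b * q u)" by simp
    then have "b * (\<alpha> (X u) * q u) = b * p u" unfolding eq(2,3) by simp
    ultimately show ?thesis using b by (simp add: zero_less_mult_iff)
  qed
  have "H (X u) = k" if "u \<in> U" for u using that sub H(2) by blast
  then show "smooth_on U (\<lambda>u. \<alpha> (X u))" "codazzi_lienard k U (\<lambda>u. \<alpha> (X u))"
    using codazzi_lienard_constant_curvature[of k "\<lambda>u. \<alpha> (X u)"] * by blast+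
qed


section \<open>Uniqueness\<close>

text \<open>The rotation with matrix \<open>[[m, -n], [n, m]]\<close> about the vertical axis, followed by the left
  translation by \<open>(a, b, e)\<close>.\<close>

definition roto_translation :: "real \<Rightarrow> real \<Rightarrow> heis \<Rightarrow> heis \<Rightarrow> heis" where
  "roto_translation m n = (\<lambda>(a, b, e) (x, y, z).
     (a + (m * x - n * y), b + (n * x + m * y),
      e + z + b * (m * x - n * y) - a * (n * x + m * y)))"

text \<open>The map is affine in the coordinates and sends the origin to \<open>g\<close>, so
  subtracting \<open>g\<close> leaves its linear part.\<close>

lemma roto_translation_has_derivative:
  "(roto_translation m n g has_derivative (\<lambda>v. roto_translation m n g v - g)) (at p)"
proof -
  obtain a b e where g: "g = (a, b, e)" by (cases g)
  have eq: "roto_translation m n g = (\<lambda>v. (a + (m * fst v - n * fst (snd v)), b + (n * fst v + m * fst (snd v)),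
      e + snd (snd v) + b * (m * fst v - n * fst (snd v)) - a * (n * fst v + m * fst (snd v))))"
    by (auto simp: g roto_translation_def)
  have "((\<lambda>v. (a + (m * fst v - n * fst (snd v)), b + (n * fst v + m * fst (snd v)),
      e + snd (snd v) + b * (m * fst v - n * fst (snd v)) - a * (n * fst v + m * fst (snd v))))
    has_derivative (\<lambda>v. (m * fst v - n * fst (snd v), n * fst v + m * fst (snd v),
      snd (snd v) + b * (m * fst v - n * fst (snd v)) - a * (n * fst v + m * fst (snd v))))) (at p)"
    by (auto intro!: derivative_eq_intros)
  moreover have "(\<lambda>v. roto_translation m n g v - g) = (\<lambda>v. (m * fst v - n * fst (snd v), n * fst v + m * fst (snd v),
      snd (snd v) + b * (m * fst v - n * fst (snd v)) - a * (n * fst v + m * fst (snd v))))"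
    by (simp add: g roto_translation_def fun_eq_iff)
  ultimately show ?thesis unfolding eq[symmetric] by simp
qed

lemma smooth_on_roto_translation: "smooth_on UNIV (roto_translation m n g)"
proof -
  have "higher_differentiable_on (Suc k) UNIV (roto_translation m n g)" for k
    by (rule higher_differentiable_on_SucI[OF open_UNIV roto_translation_has_derivative
          higher_differentiable_on_const])
  then show ?thesis unfolding smooth_on_def by (metis higher_differentiable_on_SucD)
qed

lemma roto_translation_inverse:
  assumes "m * m + n * n = 1"
  obtains g' where "roto_translation m (- n) g' \<circ> roto_translation m n g = id"
    "roto_translation m n g \<circ> roto_translation m (- n) g' = id"
proof -
  obtain a b e where g: "g = (a, b, e)" by (cases g)
  \<comment> \<open>The group inverse (-a, -b, -e) of \<open>g\<close>, rotated back by the inverse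
    rotation.\<close>
  define g' where "g' = (- (m * a + n * b), n * a - m * b, - e)"
  have "roto_translation m (- n) g' (roto_translation m n g (x, y, z)) = (x, y, z)" for x y z
    using assms unfolding g g'_def roto_translation_def prod.case prod.inject by algebra
  moreover have "roto_translation m n g (roto_translation m (- n) g' (x, y, z)) = (x, y, z)" for x y z
    using assms unfolding g g'_def roto_translation_def prod.case prod.inject by algebra
  ultimately show ?thesis using that[of g'] by (auto simp: fun_eq_iff)
qed

lemma heis_rigid_motion_roto_translation:
  assumes "m * m + n * n = 1"
  shows "heis_rigid_motion (roto_translation m n g)"
proof -
  obtain g' where g': "roto_translation m (- n) g' \<circ> roto_translation m n g = id"
    "roto_translation m n g \<circ> roto_translation m (- n) g' = id"
    using roto_translation_inverse[OF assms] .
  have "bij (roto_translation m n g)" using g' by (rule o_bij)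
  moreover have "inv (roto_translation m n g) = roto_translation m (- n) g'"
    using g' by (metis inv_unique_comp)
  moreover have "frechet_derivative (roto_translation m n g) (at p) = (\<lambda>v. roto_translation m n g v - g)" for p
    using frechet_derivative_at[OF roto_translation_has_derivative] by metis
  moreover have "contact_form (roto_translation m n g p) (roto_translation m n g v - g) = contact_form p v" for p v
  proof -
    obtain a b e where g: "g = (a, b, e)" by (cases g)
    obtain x y z where p: "p = (x, y, z)" by (cases p)
    obtain v1 v2 v3 where v: "v = (v1, v2, v3)" by (cases v)
    show ?thesis using assms
      unfolding g p v roto_translation_def contact_form_def prod.case diff_Pair by algebra
  qed
  moreover have "roto_translation m n g (heis_J p v) - g
      = heis_J (roto_translation m n g p) (roto_translation m n g v - g)" for p v
  proof -
    obtain a b e where g: "g = (a, b, e)" by (cases g)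
    obtain x y z where p: "p = (x, y, z)" by (cases p)
    obtain v1 v2 v3 where v: "v = (v1, v2, v3)" by (cases v)
    show ?thesis using assms
      unfolding g p v by (simp add: roto_translation_def heis_J_def frame_coords_def std_e1_def
          std_e2_def) (algebra)
  qed
  ultimately show ?thesis
    unfolding heis_rigid_motion_def using smooth_on_roto_translation by simp
qed

lemma constant_of_partials:
  fixes f :: "real \<times> real \<Rightarrow> real"
  assumes V: "open V" "connected V" and f: "smooth_on V f"
    and 0: "\<And>v. v \<in> V \<Longrightarrow> partial_x f v = 0" "\<And>v. v \<in> V \<Longrightarrow> partial_y f v = 0"
    and uv: "u \<in> V" "v \<in> V"
  shows "f u = f v"
proof (rule has_derivative_zero_unique_connected[OF V _ uv])
  show "(f has_derivative (\<lambda>_. 0)) (at w)" if "w \<in> V" for w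
    using smooth_on_has_derivative_partials[OF f that] by (simp add: 0[OF that])
qed


text \<open>Equal \<open>p\<close>, \<open>r\<close> and \<kappa> give both angles the same
  derivatives, so their difference is constant on the connected set \<open>V\<close>. After this
  rotation, \<open>X'\<close> and \<open>X\<close> satisfy the same first order equations up to a
  left translation, whose components are found as constants one after the other.\<close>

lemma characteristic_patches_congruent:
  assumes X: "characteristic_patch V X \<kappa>" and X': "characteristic_patch V X' \<kappa>"
    and conn: "connected V"
    and p: "\<And>u. u \<in> V \<Longrightarrow> characteristic_patch.p X u = characteristic_patch.p X' u"
    and q: "\<And>u. u \<in> V \<Longrightarrow> characteristic_patch.q X u = characteristic_patch.q X' u"
    and r: "\<And>u. u \<in> V \<Longrightarrow> characteristic_patch.r X u = characteristic_patch.r X' u"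
  obtains \<Phi> where "heis_rigid_motion \<Phi>" "\<And>v. v \<in> V \<Longrightarrow> X' v = \<Phi> (X v)"
proof (cases "V = {}")
  case True
  then show ?thesis
    using that[OF heis_rigid_motion_roto_translation[of 1 0]] by simp
next
  case False
  then obtain v0 where v0: "v0 \<in> V" by blast
  interpret A: characteristic_patch V X \<kappa> by fact
  interpret B: characteristic_patch V X' \<kappa> by fact
  note V = A.open_U
  note const = constant_of_partials[OF V conn _ _ _ _ v0]
  have \<omega>: "A.\<omega> u = B.\<omega> u" if u: "u \<in> V" for u
    using partial_cong(1)[OF V u p A.smooth_pqr(1)] r[OF u] by (simp add: A.\<omega>_def B.\<omega>_def)
  \<comment> \<open>\<open>m\<close> and \<open>n\<close> are the cosine and sine of the angle of
    \<open>X'\<close> minus that of \<open>X\<close>, so no angle function has to be chosen.\<close>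
  define m where "m = A.c v0 * B.c v0 + A.s v0 * B.s v0"
  define n where "n = A.c v0 * B.s v0 - A.s v0 * B.c v0"
  have mn: "m * m + n * n = 1"
    using A.unit'[OF v0] B.unit'[OF v0] unfolding m_def n_def by algebra
  note smooth = A.smooth_cs B.smooth_cs A.smooth_coords B.smooth_coords
  note diff = smooth[THEN smooth_on_differentiable]
  note calc = partial_algebra diff differentiable_mult differentiable_add differentiable_diff
  have m: "A.c v * B.c v + A.s v * B.s v = m" if v: "v \<in> V" for v
    unfolding m_def
  proof (rule const[OF _ _ _ v])
    show "smooth_on V (\<lambda>v. A.c v * B.c v + A.s v * B.s v)" by (intro smooth_on_intros V smooth)
  qed (simp_all add: calc A.turn' B.turn' A.structure_equations B.structure_equations \<omega>)
  have n: "A.c v * B.s v - A.s v * B.c v = n" if v: "v \<in> V" for v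
    unfolding n_def
  proof (rule const[OF _ _ _ v])
    show "smooth_on V (\<lambda>v. A.c v * B.s v - A.s v * B.c v)" by (intro smooth_on_intros V smooth)
  qed (simp_all add: calc A.turn' B.turn' A.structure_equations B.structure_equations \<omega>)
  \<comment> \<open>The addition formulas for cosine and sine: the angle of \<open>X'\<close> is
    that of \<open>X\<close> plus the constant one.\<close>
  have c: "B.c v = m * A.c v - n * A.s v" and s: "B.s v = n * A.c v + m * A.s v" if v: "v \<in> V" for v
    using A.unit'[OF v] unfolding m[OF v, symmetric] n[OF v, symmetric] by algebra+
  define f1 where "f1 = (\<lambda>v. B.x1 v - (m * A.x1 v - n * A.x2 v))"
  define f2 where "f2 = (\<lambda>v. B.x2 v - (n * A.x1 v + m * A.x2 v))"
  define a where "a = f1 v0"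
  define b where "b = f2 v0"
  have x1: "f1 v = a" if v: "v \<in> V" for v
    unfolding a_def
  proof (rule const[OF _ _ _ v])
    show "smooth_on V f1" unfolding f1_def by (intro smooth_on_intros V smooth)
    show "partial_x f1 u = 0" "partial_y f1 u = 0" if u: "u \<in> V" for u
      using u unfolding f1_def
      by (simp_all add: calc A.partial_X B.partial_X A.partial_y_coords B.partial_y_coords
          c s p q r) (simp add: algebra_simps)
  qed
  have x2: "f2 v = b" if v: "v \<in> V" for v
    unfolding b_def
  proof (rule const[OF _ _ _ v])
    show "smooth_on V f2" unfolding f2_def by (intro smooth_on_intros V smooth)
    show "partial_x f2 u = 0" "partial_y f2 u = 0" if u: "u \<in> V" for u
      using u unfolding f2_def
      by (simp_all add: calc A.partial_X B.partial_X A.partial_y_coords B.partial_y_coords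
          c s p q r) (simp add: algebra_simps)
  qed
  have x1': "B.x1 v = a + (m * A.x1 v - n * A.x2 v)" and x2': "B.x2 v = b + (n * A.x1 v + m * A.x2 v)"
    if v: "v \<in> V" for v
    using x1[OF v] x2[OF v] by (simp_all add: f1_def f2_def)
  \<comment> \<open>The third coordinate of \<open>X'\<close> minus the one obtained from
    \<open>X\<close> by the rotation and the left translation by (a, b, 0). The twist terms contain
    \<open>a\<close> and \<open>b\<close>, which is why the first two coordinates are settled
    beforehand.\<close>
  define f3 where "f3 = (\<lambda>v. B.x3 v - (A.x3 v + b * (m * A.x1 v - n * A.x2 v) - a * (n * A.x1 v + m * A.x2 v)))"
  define e where "e = f3 v0"
  have x3: "f3 v = e" if v: "v \<in> V" for v
    unfolding e_def
  proof (rule const[OF _ _ _ v])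
    show "smooth_on V f3" unfolding f3_def by (intro smooth_on_intros V smooth)
    fix u assume u: "u \<in> V"
    have "partial_x f3 u = (B.x2 u * B.c u - B.x1 u * B.s u)
      - (A.x2 u * A.c u - A.x1 u * A.s u + b * (m * A.c u - n * A.s u) - a * (n * A.c u + m * A.s u))"
      using u unfolding f3_def by (simp add: calc A.partial_X B.partial_X A.partial_x3 B.partial_x3)
    also have "\<dots> = 0"
      unfolding x1'[OF u] x2'[OF u] c[OF u] s[OF u] using mn by algebra
    finally show "partial_x f3 u = 0" .
    have "partial_y f3 u = (B.q u - B.x1 u * (B.r u * B.s u + B.p u * B.c u) + B.x2 u * (B.r u * B.c u - B.p u * B.s u))
      - ((A.q u - A.x1 u * (A.r u * A.s u + A.p u * A.c u) + A.x2 u * (A.r u * A.c u - A.p u * A.s u))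
        + b * (m * (A.r u * A.c u - A.p u * A.s u) - n * (A.r u * A.s u + A.p u * A.c u))
        - a * (n * (A.r u * A.c u - A.p u * A.s u) + m * (A.r u * A.s u + A.p u * A.c u)))"
      using u unfolding f3_def by (simp add: calc A.partial_y_coords B.partial_y_coords)
    also have "\<dots> = 0"
      unfolding x1'[OF u] x2'[OF u] c[OF u] s[OF u] p[OF u] q[OF u] r[OF u] using mn by algebra
    finally show "partial_y f3 u = 0" .
  qed
  have "X' v = roto_translation m n (a, b, e) (X v)" if v: "v \<in> V" for v
    using x3[OF v] by (simp add: A.X_eq B.X_eq roto_translation_def x1'[OF v] x2'[OF v] f3_def)
  then show ?thesis using that[OF heis_rigid_motion_roto_translation[OF mn]] by blast
qed

lemma embedding_with_frame_patch:
  assumes "embedding_with_frame V X \<alpha> H a b"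
  shows "characteristic_patch V X H"
    "u \<in> V \<Longrightarrow> a u + b u * characteristic_patch.r X u = 0"
    "u \<in> V \<Longrightarrow> b u * characteristic_patch.p X u = \<alpha> u / sqrt (1 + (\<alpha> u)\<^sup>2)"
    "u \<in> V \<Longrightarrow> b u * characteristic_patch.q X u = 1 / sqrt (1 + (\<alpha> u)\<^sup>2)"
proof -
  obtain E where emb: "smooth_embedding V X" and E: "characteristic_field (X ` V) E"
    "p_mean_curvature (X ` V) E (on_surface V X H)"
    and X_x: "\<And>u. u \<in> V \<Longrightarrow> E (X u) = partial_x X u"
    and e2: "\<And>u. u \<in> V \<Longrightarrow> e2_hat E (on_surface V X \<alpha>) (X u) = a u *\<^sub>R partial_x X u + b u *\<^sub>R partial_y X u"
    using assms unfolding embedding_with_frame_def embedding_with_invariants_def by metis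
  have V: "open V" and X: "smooth_on V X" using emb by (auto simp: smooth_embedding_def)
  note inj = smooth_embedding_inj_on[OF emb]
  have patch: "characteristic_patch V X (\<lambda>u. on_surface V X H (X u))"
    by (rule surface_characteristic_patch[OF V X _ E]) (simp_all add: X_x)
  then show "characteristic_patch V X H"
    by (simp add: characteristic_patch_def on_surface_eq[OF inj])
  note coeff = characteristic_patch.e2_hat_coefficients[OF patch _ X_x e2]
  show "u \<in> V \<Longrightarrow> a u + b u * characteristic_patch.r X u = 0"
    "u \<in> V \<Longrightarrow> b u * characteristic_patch.p X u = \<alpha> u / sqrt (1 + (\<alpha> u)\<^sup>2)"
    "u \<in> V \<Longrightarrow> b u * characteristic_patch.q X u = 1 / sqrt (1 + (\<alpha> u)\<^sup>2)"
    using coeff by (simp_all add: on_surface_eq[OF inj])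
qed

text \<open>As \<open>b\<close> does not vanish, the three relations for the coefficients of
  \<open>e2_hat\<close> can be solved for \<open>r\<close>, \<open>p\<close> and \<open>q\<close>,
  which therefore agree for the two embeddings.\<close>

proposition embedding_with_frame_unique:
  assumes conn: "connected V" and b: "\<And>u. u \<in> V \<Longrightarrow> b u \<noteq> 0"
    and X: "embedding_with_frame V X \<alpha> H a b" and X': "embedding_with_frame V X' \<alpha> H a b"
  shows "\<exists>\<Phi>. heis_rigid_motion \<Phi> \<and> (\<forall>v\<in>V. X' v = \<Phi> (X v))"
proof -
  note P = embedding_with_frame_patch[OF X] and P' = embedding_with_frame_patch[OF X']
  have "b u * characteristic_patch.r X u = b u * characteristic_patch.r X' u" if "u \<in> V" for u
    using P(2)[OF that] P'(2)[OF that] by linarith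
  then have "characteristic_patch.r X u = characteristic_patch.r X' u"
    "characteristic_patch.p X u = characteristic_patch.p X' u"
    "characteristic_patch.q X u = characteristic_patch.q X' u" if "u \<in> V" for u
    using b[OF that] P(3,4)[OF that] P'(3,4)[OF that] that by (metis mult_left_cancel)+
  then show ?thesis
    using characteristic_patches_congruent[OF P(1) P'(1) conn] by metis
qed


section \<open>Existence\<close>

text \<open>The equations \<open>\<theta>\<^sub>x = H\<close>, \<open>\<theta>\<^sub>y = p\<^sub>x + H r\<close> for the angle \<open>\<theta>\<close> of the characteristic direction,
  and then \<open>X\<^sub>x = e\<^sub>1\<close>, \<open>X\<^sub>y = r e\<^sub>1 + p J e\<^sub>1 + q T\<close>, are closed one-forms once the structure equations
  for \<open>p\<close>, \<open>q\<close>, \<open>r\<close> hold.\<close>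

lemma integrate_structure_equations:
  fixes H p q r :: "real \<times> real \<Rightarrow> real"
  assumes U: "open U" and u0: "u0 \<in> U"
    and H: "smooth_on U H" and pqr: "smooth_on U p" "smooth_on U q" "smooth_on U r"
    and r_x: "\<And>u. u \<in> U \<Longrightarrow> partial_x r u = H u * p u"
    and q_x: "\<And>u. u \<in> U \<Longrightarrow> partial_x q u = 2 * p u"
    and H_y: "\<And>u. u \<in> U \<Longrightarrow> partial_y H u = partial_x (\<lambda>u. partial_x p u + H u * r u) u"
  obtains V X c s where "open V" "u0 \<in> V" "V \<subseteq> U" "smooth_on V X" "smooth_on V c" "smooth_on V s"
    "\<And>u. u \<in> V \<Longrightarrow> (c u)\<^sup>2 + (s u)\<^sup>2 = 1"
    "\<And>u. u \<in> V \<Longrightarrow> partial_x c u = - H u * s u" "\<And>u. u \<in> V \<Longrightarrow> partial_x s u = H u * c u"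
    "\<And>u. u \<in> V \<Longrightarrow> partial_x X u = from_frame (X u) (c u, s u, 0)"
    "\<And>u. u \<in> V \<Longrightarrow> partial_y X u = from_frame (X u) (r u * c u - p u * s u, r u * s u + p u * c u, q u)"
proof -
  have "smooth_on U (\<lambda>u. partial_x p u + H u * r u)"
    by (intro smooth_on_intros U H pqr)
  from local_primitive[OF U H this u0 H_y]
  obtain V1 \<theta> where V1: "open V1" "u0 \<in> V1" "V1 \<subseteq> U" and \<theta>: "smooth_on V1 \<theta>"
    and \<theta>_x: "\<And>v. v \<in> V1 \<Longrightarrow> partial_x \<theta> v = H v"
    and \<theta>_y: "\<And>v. v \<in> V1 \<Longrightarrow> partial_y \<theta> v = partial_x p v + H v * r v"
    by blast
  define c where "c = (\<lambda>u. cos (\<theta> u))"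
  define s where "s = (\<lambda>u. sin (\<theta> u))"
  have cs: "smooth_on V1 c" "smooth_on V1 s"
    unfolding c_def s_def by (intro smooth_on_intros V1 \<theta>)+
  note pqr1 = pqr[THEN smooth_on_subset, OF V1(3)]
  have unit: "c u * c u + s u * s u = 1" for u
    using sin_cos_squared_add[of "\<theta> u"] by (simp add: c_def s_def power2_eq_square)
  have cs_x: "partial_x c u = - H u * s u" "partial_x s u = H u * c u"
    and cs_y: "partial_y c u = - (partial_x p u + H u * r u) * s u"
      "partial_y s u = (partial_x p u + H u * r u) * c u" if u: "u \<in> V1" for u
    using partial_real_comp[OF smooth_on_differentiable[OF \<theta> u] DERIV_cos]
      partial_real_comp[OF smooth_on_differentiable[OF \<theta> u] DERIV_sin]
    unfolding c_def s_def \<theta>_x[OF u] \<theta>_y[OF u] by (simp_all add: algebra_simps)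
  define l where "l = (\<lambda>u. r u * c u - p u * s u)"
  define m where "m = (\<lambda>u. r u * s u + p u * c u)"
  have lm: "smooth_on V1 l" "smooth_on V1 m"
    unfolding l_def m_def by (intro smooth_on_intros V1 cs pqr1)+
  \<comment> \<open>Closedness of the forms \<open>c dx + l dy\<close> and
    \<open>s dx + m dy\<close> for the first two coordinates; the terms in \<open>r_x\<close> and
    \<open>H p\<close> cancel.\<close>
  have lm_x: "partial_x l u = partial_y c u" "partial_x m u = partial_y s u" if u: "u \<in> V1" for u
  proof -
    have D: "c differentiable (at u)" "s differentiable (at u)" "p differentiable (at u)"
      "r differentiable (at u)"
      using u cs pqr1 smooth_on_differentiable by blast+
    have "u \<in> U" using u V1 by blast
    then show "partial_x l u = partial_y c u" "partial_x m u = partial_y s u"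
      unfolding l_def m_def
      by (simp_all add: partial_algebra D differentiable_mult cs_x[OF u] cs_y[OF u] r_x algebra_simps)
  qed
  obtain V2 x1 where V2: "open V2" "u0 \<in> V2" "V2 \<subseteq> V1" and x1: "smooth_on V2 x1"
    and x1_x: "\<And>v. v \<in> V2 \<Longrightarrow> partial_x x1 v = c v" and x1_y: "\<And>v. v \<in> V2 \<Longrightarrow> partial_y x1 v = l v"
    using local_primitive[OF V1(1) cs(1) lm(1) V1(2)] lm_x(1) by metis
  note cs2 = cs[THEN smooth_on_subset, OF V2(3)] and lm2 = lm[THEN smooth_on_subset, OF V2(3)]
  have "partial_y s v = partial_x m v" if "v \<in> V2" for v
    using lm_x(2)[OF subsetD[OF V2(3) that]] by simp
  from local_primitive[OF V2(1) cs2(2) lm2(2) V2(2) this]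
  obtain V3 x2 where V3: "open V3" "u0 \<in> V3" "V3 \<subseteq> V2" and x2: "smooth_on V3 x2"
    and x2_x: "\<And>v. v \<in> V3 \<Longrightarrow> partial_x x2 v = s v" and x2_y: "\<And>v. v \<in> V3 \<Longrightarrow> partial_y x2 v = m v"
    by blast
  have sub3: "V3 \<subseteq> V1" "V3 \<subseteq> U" using V1 V2 V3 by auto
  note sm3 = x1[THEN smooth_on_subset, OF V3(3)] x2 cs[THEN smooth_on_subset, OF sub3(1)]
    lm[THEN smooth_on_subset, OF sub3(1)] pqr(2)[THEN smooth_on_subset, OF sub3(2)]
  define A where "A = (\<lambda>u. x2 u * c u - x1 u * s u)"
  define B where "B = (\<lambda>u. q u - x1 u * m u + x2 u * l u)"
  have AB: "smooth_on V3 A" "smooth_on V3 B"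
    unfolding A_def B_def by (intro smooth_on_intros V3 sm3)+
  have "partial_y A u = partial_x B u" if u: "u \<in> V3" for u
  proof -
    have u': "u \<in> V2" "u \<in> V1" "u \<in> U" using u V3 sub3 by auto
    note D = sm3[THEN smooth_on_differentiable, OF u]
    have "partial_y A u = m u * c u + x2 u * partial_y c u - (l u * s u + x1 u * partial_y s u)"
      unfolding A_def by (simp add: partial_algebra D differentiable_mult x1_y u u' x2_y)
    moreover have "partial_x B u = 2 * p u - (c u * m u + x1 u * partial_y s u) + (s u * l u + x2 u * partial_y c u)"
      unfolding B_def by (simp add: partial_algebra D differentiable_mult differentiable_diff
          x1_x u u' x2_x lm_x q_x)
    \<comment> \<open>All terms with \<open>x1\<close> and \<open>x2\<close> cancel, and closedness
      of \<open>A dx + B dy\<close> reduces to \<open>q_x = 2 (c m - s l)\<close>.\<close>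
    moreover have "c u * m u - s u * l u = p u"
      using unit[of u] unfolding l_def m_def by algebra
    ultimately show ?thesis by algebra
  qed
  from local_primitive[OF V3(1) AB V3(2) this]
  obtain V x3 where V: "open V" "u0 \<in> V" "V \<subseteq> V3" and x3: "smooth_on V x3"
    and x3_x: "\<And>v. v \<in> V \<Longrightarrow> partial_x x3 v = A v" and x3_y: "\<And>v. v \<in> V \<Longrightarrow> partial_y x3 v = B v"
    by blast
  define X where "X = (\<lambda>u. (x1 u, x2 u, x3 u))"
  have subV: "V \<subseteq> V1" "V \<subseteq> V2" "V \<subseteq> U" using V sub3 V3 by auto
  have sm: "smooth_on V x1" "smooth_on V x2"
    using x1 x2 subV V smooth_on_subset by blast+
  have partial_X: "partial_x X u = (c u, s u, A u)" "partial_y X u = (l u, m u, B u)" if u: "u \<in> V" for u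
  proof -
    have "u \<in> V2" "u \<in> V3" using u subV V by blast+
    then show "partial_x X u = (c u, s u, A u)" "partial_y X u = (l u, m u, B u)"
      using partial_eqI[OF has_derivative_Pair[OF smooth_on_has_derivative_partials[OF sm(1) u]
            has_derivative_Pair[OF smooth_on_has_derivative_partials[OF sm(2) u]
              smooth_on_has_derivative_partials[OF x3 u]]]] u
      by (simp_all add: X_def x1_x x1_y x2_x x2_y x3_x x3_y)
  qed
  show ?thesis
  proof (rule that[OF V(1,2) subV(3), of X c s])
    show "smooth_on V X" unfolding X_def by (intro smooth_on_intros V sm x3)
    show "smooth_on V c" "smooth_on V s" using cs smooth_on_subset subV(1) by blast+
    fix u assume u: "u \<in> V"
    show "(c u)\<^sup>2 + (s u)\<^sup>2 = 1" using unit[of u] by (simp add: power2_eq_square)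
    show "partial_x c u = - H u * s u" "partial_x s u = H u * c u"
      using u subV cs_x by blast+
    show "partial_x X u = from_frame (X u) (c u, s u, 0)"
      "partial_y X u = from_frame (X u) (r u * c u - p u * s u, r u * s u + p u * c u, q u)"
      unfolding partial_X[OF u]
      by (simp_all add: from_frame_def std_e1_def std_e2_def reeb_def X_def A_def B_def
          l_def m_def algebra_simps)
  qed
qed

text \<open>A vector in the kernel has no y-component because the \<open>T\<close>-component
  \<open>q\<close> of \<open>X_y\<close> is nonzero, and then no x-component because
  \<open>X_x\<close> is a unit vector.\<close>

lemma frame_immersion_inj:
  assumes X: "X differentiable (at u)" and unit: "c\<^sup>2 + s\<^sup>2 = 1" and q: "q \<noteq> 0"
    and X_x: "partial_x X u = from_frame (X u) (c, s, 0)"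
    and X_y: "partial_y X u = from_frame (X u) (l, m, q)"
  shows "inj (frechet_derivative X (at u))"
proof -
  have D: "(X has_derivative frechet_derivative X (at u)) (at u)"
    using X frechet_derivative_works by blast
  have eq: "frechet_derivative X (at u) v = from_frame (X u) (fst v *\<^sub>R (c, s, 0) + snd v *\<^sub>R (l, m, q))" for v
    using fun_cong[OF has_derivative_unique[OF D differentiable_has_derivative_partials[OF X]], of v]
    by (simp add: X_x X_y from_frame_linear)
  have "v = 0" if "frechet_derivative X (at u) v = 0" for v
  proof -
    have "from_frame (X u) (fst v *\<^sub>R (c, s, 0) + snd v *\<^sub>R (l, m, q)) = from_frame (X u) 0"
      using that by (simp add: eq zero_prod_def) (simp add: from_frame_def zero_prod_def)
    then have *: "fst v * c + snd v * l = 0" "fst v * s + snd v * m = 0" "snd v * q = 0"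
      by (simp_all add: zero_prod_def)
    then have "snd v = 0" using q by simp
    moreover have "fst v = 0" using * calculation unit by auto
    ultimately show "v = 0" by (simp add: prod_eq_iff)
  qed
  then show ?thesis
    using linear_injective_0[OF has_derivative_linear[OF D]] by blast
qed

proposition local_embedding_exists:
  assumes U: "open U" and \<alpha>: "smooth_on U \<alpha>" and H: "smooth_on U H"
    and PQ: "fixed_antiderivatives U \<alpha> H P Q"
    and k: "smooth_on (snd ` U) k" and h: "smooth_on (snd ` U) h"
    and int: "integrability_condition U \<alpha> H P Q k h" and u0: "u0 \<in> U"
  shows "\<exists>V. open V \<and> connected V \<and> u0 \<in> V \<and> V \<subseteq> U \<and>
    (\<exists>X. embedding_with_frame V X \<alpha> H (coeff_a \<alpha> P Q h) (coeff_b \<alpha> P k))"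
proof -
  have P: "smooth_on U P" and P_x: "\<And>u. u \<in> U \<Longrightarrow> partial_x P u = 2 * \<alpha> u"
    and Q: "smooth_on U Q" and Q_x: "\<And>u. u \<in> U \<Longrightarrow> partial_x Q u = H u * \<alpha> u * exp (P u)"
    using PQ by (auto simp: fixed_antiderivatives_def)
  have snd_U: "open (snd ` U)" using U by (rule open_image_snd)
  have snd: "smooth_on U (snd :: real \<times> real \<Rightarrow> real)"
    by (rule smooth_on_linear[OF bounded_linear_snd U])
  have kh: "smooth_on U (\<lambda>u. k (snd u))" "smooth_on U (\<lambda>u. h (snd u))"
    using smooth_on_real_comp[OF k U snd_U _ snd] smooth_on_real_comp[OF h U snd_U _ snd] by auto
  have kh_x: "partial_x (\<lambda>u. k (snd u)) u = 0" "partial_x (\<lambda>u. h (snd u)) u = 0" if "u \<in> U" for u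
    using partial_snd_comp[OF smooth_on_differentiable[OF k]] partial_snd_comp[OF smooth_on_differentiable[OF h]] that
    by auto
  \<comment> \<open>These solve \<open>b q = 1 / sqrt (1 + \<alpha>\<^sup>2)\<close> and
    \<open>a + b r = 0\<close> for the prescribed \<open>a\<close> and \<open>b\<close>; in the
    quotient \<open>a / b\<close> the exponential of \<open>P\<close> and the square root
    cancel.\<close>
  define q where "q = (\<lambda>u. exp (P u - k (snd u)))"
  define p where "p = (\<lambda>u. \<alpha> u * q u)"
  define r where "r = (\<lambda>u. - (exp (- k (snd u)) * (h (snd u) - Q u)))"
  have q: "smooth_on U q" unfolding q_def by (intro smooth_on_intros U P kh)
  have p: "smooth_on U p" unfolding p_def by (intro smooth_on_intros U q \<alpha>)
  have r: "smooth_on U r" unfolding r_def by (intro smooth_on_intros U Q kh)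
  have q_x: "partial_x q u = 2 * p u" if u: "u \<in> U" for u
  proof -
    note D = smooth_on_differentiable[OF P u] smooth_on_differentiable[OF kh(1) u]
    have "partial_x (\<lambda>u. P u - k (snd u)) u = 2 * \<alpha> u"
      using partial_algebra(3)[OF D] by (simp add: P_x[OF u] kh_x[OF u])
    then show ?thesis
      using partial_real_comp(1)[OF differentiable_diff[OF D] DERIV_exp] by (simp add: q_def p_def)
  qed
  have r_x: "partial_x r u = H u * p u" if u: "u \<in> U" for u
  proof -
    note D = smooth_on_differentiable[OF Q u] smooth_on_differentiable[OF kh(1) u] smooth_on_differentiable[OF kh(2) u]
    have 1: "(\<lambda>u. exp (- k (snd u))) differentiable (at u)"
      by (rule smooth_on_differentiable[OF _ u]) (intro smooth_on_intros U kh)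
    have 2: "partial_x (\<lambda>u. exp (- k (snd u))) u = 0"
      using partial_real_comp(1)[OF differentiable_minus[OF D(2)] DERIV_exp] partial_minus(1)[OF D(2)] kh_x(1)[OF u]
      by simp
    have "partial_x r u = exp (- k (snd u)) * partial_x Q u"
      unfolding r_def using 1 2
      by (simp add: partial_minus partial_algebra D differentiable_diff differentiable_mult kh_x[OF u])
    then show ?thesis by (simp add: Q_x[OF u] p_def q_def exp_diff exp_minus field_simps)
  qed
  have p_x: "partial_x p u = (partial_x \<alpha> u + 2 * (\<alpha> u * \<alpha> u)) * q u" if u: "u \<in> U" for u
    unfolding p_def using smooth_on_differentiable[OF \<alpha> u] smooth_on_differentiable[OF q u]
    by (simp add: partial_algebra q_x[OF u]) (simp add: p_def algebra_simps)
  have p_xx: "partial_x (partial_x p) u = (partial_x (partial_x \<alpha>) u + 6 * \<alpha> u * partial_x \<alpha> u + 4 * (\<alpha> u)^3) * q u"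
    if u: "u \<in> U" for u
  proof -
    note D = smooth_on_differentiable[OF \<alpha> u] smooth_on_differentiable[OF q u]
      smooth_on_differentiable[OF smooth_on_partial(1)[OF \<alpha>] u]
    have "partial_x (partial_x p) u = partial_x (\<lambda>u. (partial_x \<alpha> u + 2 * (\<alpha> u * \<alpha> u)) * q u) u"
      by (rule partial_cong(1)[OF U u p_x smooth_on_partial(1)[OF p]])
    also have "\<dots> = (partial_x (partial_x \<alpha>) u + 2 * (2 * \<alpha> u * partial_x \<alpha> u)) * q u
        + (partial_x \<alpha> u + 2 * (\<alpha> u * \<alpha> u)) * (2 * p u)"
      by (simp add: partial_algebra D differentiable_add differentiable_mult q_x[OF u])
    finally show ?thesis unfolding p_def by algebra
  qed
  have H_y: "partial_y H u = partial_x (\<lambda>u. partial_x p u + H u * r u) u" if u: "u \<in> U" for u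
  proof -
    \<comment> \<open>Multiplying by the exponential of k turns \<open>q\<close> into the
      exponential of \<open>P\<close> and \<open>r\<close> into \<open>Q - h\<close>, the
      coefficients that occur in the integrability condition.\<close>
    define e where "e = exp (k (snd u))"
    have "e > 0" by (simp add: e_def)
    note D = smooth_on_differentiable[OF H u] smooth_on_differentiable[OF r u]
      smooth_on_differentiable[OF smooth_on_partial(1)[OF p] u]
    have eq: "e * q u = exp (P u)" "e * r u = - (h (snd u) - Q u)"
      using \<open>e > 0\<close> by (simp_all add: e_def q_def r_def exp_diff exp_minus mult.assoc[symmetric])
    have "partial_x (\<lambda>u. partial_x p u + H u * r u) u
      = partial_x (partial_x p) u + (partial_x H u * r u + H u * (H u * p u))"
      by (simp add: partial_algebra D differentiable_mult r_x[OF u])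
    also have "e * \<dots> = (partial_x (partial_x \<alpha>) u + 6 * \<alpha> u * partial_x \<alpha> u + 4 * (\<alpha> u)^3 + \<alpha> u * (H u)\<^sup>2) * (e * q u)
        + partial_x H u * (e * r u)"
      unfolding p_xx[OF u] unfolding p_def by algebra
    also have "\<dots> = e * partial_y H u"
    proof -
      have "(h (snd u) - Q u) * partial_x H u + e * partial_y H u = exp (P u) *
          (partial_x (partial_x \<alpha>) u + 6 * \<alpha> u * partial_x \<alpha> u + 4 * (\<alpha> u)^3 + \<alpha> u * (H u)\<^sup>2)"
        using int u by (simp add: integrability_condition_def e_def)
      then show ?thesis unfolding eq by algebra
    qed
    finally show ?thesis using \<open>e > 0\<close> by simp
  qed
  obtain W X c s where W: "open W" "u0 \<in> W" "W \<subseteq> U" and X: "smooth_on W X"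
    and cs: "smooth_on W c" "smooth_on W s" and unit: "\<And>u. u \<in> W \<Longrightarrow> (c u)\<^sup>2 + (s u)\<^sup>2 = 1"
    and cs_x: "\<And>u. u \<in> W \<Longrightarrow> partial_x c u = - H u * s u" "\<And>u. u \<in> W \<Longrightarrow> partial_x s u = H u * c u"
    and X_x: "\<And>u. u \<in> W \<Longrightarrow> partial_x X u = from_frame (X u) (c u, s u, 0)"
    and X_y: "\<And>u. u \<in> W \<Longrightarrow> partial_y X u = from_frame (X u) (r u * c u - p u * s u, r u * s u + p u * c u, q u)"
    using integrate_structure_equations[OF U u0 H p q r r_x q_x H_y] by blast
  have "inj (frechet_derivative X (at v))" if "v \<in> W" for v
    by (rule frame_immersion_inj[OF smooth_on_differentiable[OF X that] unit[OF that] _ X_x[OF that] X_y[OF that]])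
      (simp add: q_def)
  from immersion_locally_embedding[OF W(1) X W(2) this]
  obtain \<rho> where \<rho>: "\<rho> > 0" "ball u0 \<rho> \<subseteq> W" "smooth_embedding (ball u0 \<rho>) X" by blast
  have "embedding_with_frame (ball u0 \<rho>) X \<alpha> H (coeff_a \<alpha> P Q h) (coeff_b \<alpha> P k)"
  proof (rule embedding_with_frameI[OF \<rho>(3) cs[THEN smooth_on_subset, OF \<rho>(2)]])
    fix u assume "u \<in> ball u0 \<rho>"
    then have u: "u \<in> W" using \<rho> by blast
    then show "(c u)\<^sup>2 + (s u)\<^sup>2 = 1" "partial_x c u = - H u * s u" "partial_x s u = H u * c u"
      "partial_x X u = from_frame (X u) (c u, s u, 0)"
      by (auto simp: unit cs_x X_x)
    define a where "a = coeff_a \<alpha> P Q h u"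
    define b where "b = coeff_b \<alpha> P k u"
    define d where "d = 1 / sqrt (1 + (\<alpha> u)\<^sup>2)"
    have bq: "b * q u = d"
      by (simp add: b_def coeff_b_def q_def d_def exp_diff exp_minus)
    have abr: "a + b * r u = 0"
      by (simp add: a_def b_def coeff_a_def coeff_b_def r_def exp_minus)
    have bp: "b * p u = d * \<alpha> u" by (simp add: p_def bq[symmetric])
    have "a *\<^sub>R partial_x X u + b *\<^sub>R partial_y X u = from_frame (X u)
        ((a + b * r u) * c u - (b * p u) * s u, (a + b * r u) * s u + (b * p u) * c u, b * q u)"
      by (simp add: X_x[OF u] X_y[OF u] from_frame_linear algebra_simps)
    also have "\<dots> = d *\<^sub>R from_frame (X u) (- \<alpha> u * s u, \<alpha> u * c u, 1)"
      by (simp add: abr bp bq from_frame_linear)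
    finally show "coeff_a \<alpha> P Q h u *\<^sub>R partial_x X u + coeff_b \<alpha> P k u *\<^sub>R partial_y X u =
         (1 / sqrt (1 + (\<alpha> u)\<^sup>2)) *\<^sub>R from_frame (X u) (- \<alpha> u * s u, \<alpha> u * c u, 1)"
      by (simp add: a_def b_def d_def)
  qed
  then show ?thesis using \<rho> W(3)
    by (intro exI[of _ "ball u0 \<rho>"]) auto
qed

text \<open>Both derivatives of a constant vanish, so the left-hand side is 0, and the exponential
  factor on the right can be cancelled.\<close>

lemma integrability_condition_const:
  "integrability_condition U \<alpha> (\<lambda>_. k) P Q f h \<longleftrightarrow> codazzi_lienard k U \<alpha>"
  by (simp add: integrability_condition_def codazzi_lienard_def mult.commute)

lemma coeff_b_nonzero: "coeff_b \<alpha> P k u \<noteq> 0"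
proof -
  have "0 < 1 + (\<alpha> u)\<^sup>2" by (simp add: add_pos_nonneg)
  then show ?thesis by (simp add: coeff_b_def)
qed

text \<open>With no antiderivatives given, \<open>P\<close> and then \<open>Q\<close> are
  constructed on successively smaller neighbourhoods. Since the condition is the same for all
  \<open>k\<close> and \<open>h\<close>, both may be taken to be 0.\<close>

proposition local_embedding_exists_constant_curvature:
  assumes U: "open U" and \<alpha>: "smooth_on U \<alpha>" and eq: "codazzi_lienard k U \<alpha>" and u0: "u0 \<in> U"
  shows "\<exists>V. open V \<and> connected V \<and> u0 \<in> V \<and> V \<subseteq> U \<and> (\<exists>X E. embedding_with_invariants V X E \<alpha> (\<lambda>_. k))"
proof -
  have "smooth_on U (\<lambda>u. 2 * \<alpha> u)" by (intro smooth_on_intros U \<alpha>)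
  from local_antiderivative_x[OF U this u0] obtain V P where V: "open V" "u0 \<in> V" "V \<subseteq> U"
    and P: "smooth_on V P" "\<And>v. v \<in> V \<Longrightarrow> partial_x P v = 2 * \<alpha> v" by blast
  have "smooth_on V (\<lambda>u. k * \<alpha> u * exp (P u))"
    by (intro smooth_on_intros V P smooth_on_subset[OF \<alpha> V(3)])
  from local_antiderivative_x[OF V(1) this V(2)] obtain W Q where W: "open W" "u0 \<in> W" "W \<subseteq> V"
    and Q: "smooth_on W Q" "\<And>v. v \<in> W \<Longrightarrow> partial_x Q v = k * \<alpha> v * exp (P v)" by blast
  have WU: "W \<subseteq> U" using V W by blast
  have "fixed_antiderivatives W \<alpha> (\<lambda>_. k) P Q"
    using P(2) Q W(3) smooth_on_subset[OF P(1) W(3)] by (auto simp: fixed_antiderivatives_def)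
  moreover have "integrability_condition W \<alpha> (\<lambda>_. k) P Q (\<lambda>_. 0) (\<lambda>_. 0)"
    using eq WU by (auto simp: integrability_condition_const codazzi_lienard_def)
  ultimately show ?thesis
    using local_embedding_exists[OF W(1) smooth_on_subset[OF \<alpha> WU] smooth_on_const _ smooth_on_const smooth_on_const _ W(2)] WU
    unfolding embedding_with_frame_def by (meson subset_trans)
qed

text \<open>Smallness of the domain is expressed by a neighbourhood \<open>V\<close> of each point
  of \<open>U\<close>. Uniqueness is stated for connected \<open>V\<close>, since the pieces of a
  disconnected surface could be moved independently. The last clause does not mention
  \<open>P\<close> and \<open>Q\<close>, because such antiderivatives need not exist on all of
  \<open>U\<close>.\<close>

theorem theorem1p1:
  shows
    "(\<forall>(S :: heis set) (E :: heis \<Rightarrow> heis) (H :: heis \<Rightarrow> real) (\<alpha> :: heis \<Rightarrow> real) (c :: real)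
        (U :: (real \<times> real) set) (X :: real \<times> real \<Rightarrow> heis).
        regular_surface S \<and> characteristic_field S E \<and>
        p_mean_curvature S E H \<and> (\<forall>p\<in>S. H p = c) \<and> alpha_function S E \<alpha> \<and>
        compatible_coordinates S E \<alpha> U X \<longrightarrow>
        smooth_on U (\<lambda>u. \<alpha> (X u)) \<and> codazzi_lienard c U (\<lambda>u. \<alpha> (X u)))
     \<and>
     (\<forall>(U :: (real \<times> real) set) (\<alpha> :: real \<times> real \<Rightarrow> real) (H :: real \<times> real \<Rightarrow> real)
        (P :: real \<times> real \<Rightarrow> real) (Q :: real \<times> real \<Rightarrow> real) (k :: real \<Rightarrow> real) (h :: real \<Rightarrow> real).
        open U \<and> smooth_on U \<alpha> \<and> smooth_on U H \<and> fixed_antiderivatives U \<alpha> H P Q \<and>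
        smooth_on (snd ` U) k \<and> smooth_on (snd ` U) h \<and>
        integrability_condition U \<alpha> H P Q k h \<longrightarrow>
        (\<forall>u\<in>U. \<exists>V. open V \<and> connected V \<and> u \<in> V \<and> V \<subseteq> U \<and>
           (\<exists>X. embedding_with_frame V X \<alpha> H (coeff_a \<alpha> P Q h) (coeff_b \<alpha> P k))) \<and>
        (\<forall>V X X'. open V \<and> connected V \<and> V \<subseteq> U \<and>
           embedding_with_frame V X \<alpha> H (coeff_a \<alpha> P Q h) (coeff_b \<alpha> P k) \<and>
           embedding_with_frame V X' \<alpha> H (coeff_a \<alpha> P Q h) (coeff_b \<alpha> P k) \<longrightarrow>
           (\<exists>\<Phi>. heis_rigid_motion \<Phi> \<and> (\<forall>v\<in>V. X' v = \<Phi> (X v)))))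
     \<and>
     (\<forall>(U :: (real \<times> real) set) (\<alpha> :: real \<times> real \<Rightarrow> real) (c :: real).
        open U \<and> smooth_on U \<alpha> \<longrightarrow>
        (\<forall>P Q k h.
           fixed_antiderivatives U \<alpha> (\<lambda>_. c) P Q \<and>
           smooth_on (snd ` U) k \<and> smooth_on (snd ` U) h \<longrightarrow>
           (integrability_condition U \<alpha> (\<lambda>_. c) P Q k h \<longleftrightarrow> codazzi_lienard c U \<alpha>) \<and>
           (codazzi_lienard c U \<alpha> \<longrightarrow>
             (\<forall>u\<in>U. \<exists>V. open V \<and> connected V \<and> u \<in> V \<and> V \<subseteq> U \<and>
                (\<exists>X. embedding_with_frame V X \<alpha> (\<lambda>_. c) (coeff_a \<alpha> P Q h) (coeff_b \<alpha> P k))))) \<and>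
        (codazzi_lienard c U \<alpha> \<longrightarrow>
           (\<forall>u\<in>U. \<exists>V. open V \<and> connected V \<and> u \<in> V \<and> V \<subseteq> U \<and>
              (\<exists>X E. embedding_with_invariants V X E \<alpha> (\<lambda>_. c)))))"
proof (intro conjI allI impI; (elim conjE)?)
  fix S E H \<alpha> c U X
  assume S: "regular_surface S" "characteristic_field S E" "p_mean_curvature S E H" "\<forall>p\<in>S. H p = c"
    "alpha_function S E \<alpha>" "compatible_coordinates S E \<alpha> U X"
  show "smooth_on U (\<lambda>u. \<alpha> (X u))" "codazzi_lienard c U (\<lambda>u. \<alpha> (X u))"
    using codazzi_lienard_surface[OF S(2,3) _ S(6)] S(4) by blast+
next
  fix U :: "(real \<times> real) set" and \<alpha> H P Q :: "real \<times> real \<Rightarrow> real" and k h :: "real \<Rightarrow> real"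
  assume U: "open U" "smooth_on U \<alpha>" "smooth_on U H" "fixed_antiderivatives U \<alpha> H P Q"
    "smooth_on (snd ` U) k" "smooth_on (snd ` U) h" "integrability_condition U \<alpha> H P Q k h"
  show "\<forall>u\<in>U. \<exists>V. open V \<and> connected V \<and> u \<in> V \<and> V \<subseteq> U \<and>
      (\<exists>X. embedding_with_frame V X \<alpha> H (coeff_a \<alpha> P Q h) (coeff_b \<alpha> P k))"
    by (intro ballI local_embedding_exists[OF U])
next
  fix U V :: "(real \<times> real) set" and \<alpha> H P Q :: "real \<times> real \<Rightarrow> real" and k h :: "real \<Rightarrow> real" and X X'
  assume V: "connected V" and X: "embedding_with_frame V X \<alpha> H (coeff_a \<alpha> P Q h) (coeff_b \<alpha> P k)"
    and X': "embedding_with_frame V X' \<alpha> H (coeff_a \<alpha> P Q h) (coeff_b \<alpha> P k)"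
  show "\<exists>\<Phi>. heis_rigid_motion \<Phi> \<and> (\<forall>v\<in>V. X' v = \<Phi> (X v))"
    by (rule embedding_with_frame_unique[OF V coeff_b_nonzero X X'])
next
  fix U :: "(real \<times> real) set" and \<alpha> P Q :: "real \<times> real \<Rightarrow> real" and c :: real and k h :: "real \<Rightarrow> real"
  assume U: "open U" "smooth_on U \<alpha>" "fixed_antiderivatives U \<alpha> (\<lambda>_. c) P Q"
    "smooth_on (snd ` U) k" "smooth_on (snd ` U) h"
  show int: "integrability_condition U \<alpha> (\<lambda>_. c) P Q k h \<longleftrightarrow> codazzi_lienard c U \<alpha>"
    by (rule integrability_condition_const)
  assume "codazzi_lienard c U \<alpha>"
  then show "\<forall>u\<in>U. \<exists>V. open V \<and> connected V \<and> u \<in> V \<and> V \<subseteq> U \<and>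
      (\<exists>X. embedding_with_frame V X \<alpha> (\<lambda>_. c) (coeff_a \<alpha> P Q h) (coeff_b \<alpha> P k))"
    unfolding int[symmetric]
    by (intro ballI local_embedding_exists[OF U(1,2) smooth_on_const U(3,4,5)])
next
  fix U :: "(real \<times> real) set" and \<alpha> :: "real \<times> real \<Rightarrow> real" and c :: real
  assume "open U" "smooth_on U \<alpha>" "codazzi_lienard c U \<alpha>"
  then show "\<forall>u\<in>U. \<exists>V. open V \<and> connected V \<and> u \<in> V \<and> V \<subseteq> U \<and> (\<exists>X E. embedding_with_invariants V X E \<alpha> (\<lambda>_. c))"
    by (intro ballI local_embedding_exists_constant_curvature)
qed

end
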